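(* Let $\Omega=\mathbb{R}$ or $\Omega=\mathbb{T}$, let $k\ge 3$, let $\rho_2>\rho_1\ge 0$ be constants, and let $f_0\in H^k(\Omega)$. Let $T>0$ and let $f\in C^1([0,T];H^k(\Omega))$ be the solution of the one-dimensional interface equation $$ f_t(x,t)=\frac{\rho_2-\rho_1}{2\pi}\,PV\!\int_{\mathbb{R}}\frac{\big(\partial_x f(x,t)-\partial_x f(x-\alpha,t)\big)\alpha}{\alpha^2+\big(f(x,t)-f(x-\alpha,t)\big)^2}\,d\alpha,\qquad f(x,0)=f_0(x). $$ Then for all $t\in[0,T]$, $$\|f(\cdot,t)\|_{L^\infty(\Omega)}\le \|f_0\|_{L^\infty(\Omega)}.$$
   Context: $\mathbb{T}=\mathbb{R}/2\pi\mathbb{Z}$; in the periodic case $f(\cdot,t)$ is regarded as a $2\pi$-periodic function on $\mathbb{R}$ and the integral is still taken over $\mathbb{R}$. $PV$ denotes the principal value at infinity, i.e. $\lim_{R\to\infty}\int_{-R}^{R}$. $f$ describes the interface $x_2=f(x_1,t)$ between two incompressible fluids of densities $\rho_1$ (above) and $\rho_2$ (below) moving by Darcy's law (Muskat problem with equal viscosities). $H^k$ is the $L^2$-based Sobolev space. *)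

theory Defs
  imports "HOL-Analysis.Analysis" "HOL-Probability.Essential_Supremum"
begin

text \<open>The spatial domain: the real line, or the torus R/2piZ (functions regarded as
  2pi-periodic functions on R, integrated over one period [0,2pi]).\<close>
datatype domain = Line | Torus

definition dom_measure :: "domain \<Rightarrow> real measure" where
  "dom_measure \<Omega> = (case \<Omega> of Line \<Rightarrow> lborel | Torus \<Rightarrow> restrict_space lborel {0..2*pi})"

definition admissible :: "domain \<Rightarrow> (real \<Rightarrow> real) \<Rightarrow> bool" where
  "admissible \<Omega> g = (case \<Omega> of Line \<Rightarrow> True | Torus \<Rightarrow> (\<forall>x. g (x + 2*pi) = g x))"

definition smooth_fun :: "(real \<Rightarrow> real) \<Rightarrow> bool" where
  "smooth_fun \<phi> = (\<forall>n x. ((deriv ^^ n) \<phi>) differentiable (at x))"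

definition test_fun :: "domain \<Rightarrow> (real \<Rightarrow> real) \<Rightarrow> bool" where
  "test_fun \<Omega> \<phi> = (smooth_fun \<phi> \<and>
     (case \<Omega> of Line \<Rightarrow> bounded {x. \<phi> x \<noteq> 0} | Torus \<Rightarrow> (\<forall>x. \<phi> (x + 2*pi) = \<phi> x)))"

definition is_wderiv :: "domain \<Rightarrow> nat \<Rightarrow> (real \<Rightarrow> real) \<Rightarrow> (real \<Rightarrow> real) \<Rightarrow> bool" where
  "is_wderiv \<Omega> j g0 g = (admissible \<Omega> g \<and> g \<in> borel_measurable borel \<and>
     integrable (dom_measure \<Omega>) (\<lambda>x. (g x)\<^sup>2) \<and>
     (\<forall>\<phi>. test_fun \<Omega> \<phi> \<longrightarrow>
        (\<integral>x. g0 x * (deriv ^^ j) \<phi> x \<partial>dom_measure \<Omega>) = (-1)^j * (\<integral>x. g x * \<phi> x \<partial>dom_measure \<Omega>)))"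

definition in_Hk :: "domain \<Rightarrow> nat \<Rightarrow> (real \<Rightarrow> real) \<Rightarrow> bool" where
  "in_Hk \<Omega> k g = (admissible \<Omega> g \<and> g \<in> borel_measurable borel \<and>
     integrable (dom_measure \<Omega>) (\<lambda>x. (g x)\<^sup>2) \<and>
     (\<forall>j\<le>k. \<exists>h. is_wderiv \<Omega> j g h))"

definition wderiv :: "domain \<Rightarrow> nat \<Rightarrow> (real \<Rightarrow> real) \<Rightarrow> (real \<Rightarrow> real)" where
  "wderiv \<Omega> j g = (SOME h. is_wderiv \<Omega> j g h)"

definition Hk_norm :: "domain \<Rightarrow> nat \<Rightarrow> (real \<Rightarrow> real) \<Rightarrow> real" where
  "Hk_norm \<Omega> k g = sqrt (\<Sum>j\<le>k. \<integral>x. (wderiv \<Omega> j g x)\<^sup>2 \<partial>dom_measure \<Omega>)"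

definition Linf_norm :: "domain \<Rightarrow> (real \<Rightarrow> real) \<Rightarrow> ereal" where
  "Linf_norm \<Omega> g = esssup (dom_measure \<Omega>) (\<lambda>x. ereal \<bar>g x\<bar>)"

definition C1_Hk_with_deriv ::
  "domain \<Rightarrow> nat \<Rightarrow> real \<Rightarrow> (real \<Rightarrow> real \<Rightarrow> real) \<Rightarrow> (real \<Rightarrow> real \<Rightarrow> real) \<Rightarrow> bool" where
  "C1_Hk_with_deriv \<Omega> k T f ft = (\<forall>t\<in>{0..T}.
      in_Hk \<Omega> k (\<lambda>x. f x t) \<and> in_Hk \<Omega> k (\<lambda>x. ft x t) \<and>
      ((\<lambda>s. Hk_norm \<Omega> k (\<lambda>x. (f x s - f x t) / (s - t) - ft x t)) \<longlongrightarrow> 0) (at t within {0..T}) \<and>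
      ((\<lambda>s. Hk_norm \<Omega> k (\<lambda>x. ft x s - ft x t)) \<longlongrightarrow> 0) (at t within {0..T}))"

definition has_PV :: "(real \<Rightarrow> real) \<Rightarrow> real \<Rightarrow> bool" where
  "has_PV h L = ((\<forall>R. set_integrable lborel {-R..R} h) \<and>
     ((\<lambda>R. set_lebesgue_integral lborel {-R..R} h) \<longlongrightarrow> L) at_top)"

definition muskat_integrand ::
  "domain \<Rightarrow> (real \<Rightarrow> real \<Rightarrow> real) \<Rightarrow> real \<Rightarrow> real \<Rightarrow> real \<Rightarrow> real" where
  "muskat_integrand \<Omega> f x t \<alpha> =
     (let fx = wderiv \<Omega> 1 (\<lambda>y. f y t) in
      (fx x - fx (x - \<alpha>)) * \<alpha> / (\<alpha>\<^sup>2 + (f x t - f (x - \<alpha>) t)\<^sup>2))"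

end

theory Submission
  imports Defs "HOL-Probability.Probability_Measure"
begin

text \<open>
  Write \<open>F\<close> for the regular representative of \<open>f (\<cdot>, t)\<close>, \<open>\<delta> \<alpha> = F x - F (x - \<alpha>)\<close> and
  \<open>a = F' x\<close>. The integrand of the interface equation is
  \<open>a \<alpha> / (\<alpha>\<^sup>2 + \<delta>\<^sup>2) - (arctan (\<delta> / \<alpha>))' - \<delta> / (\<alpha>\<^sup>2 + \<delta>\<^sup>2)\<close>. At a maximum \<open>a = 0\<close> and
  \<open>\<delta> \<ge> 0\<close>, while the exact derivative contributes nothing to the principal value, so the velocity
  is nonpositive there. Since the equation is only known almost everywhere and a supremum over the
  line need not be attained, this is used in the quantitative form that the velocity is at most
  \<open>\<eta>\<close> at points where \<open>F\<close> is within \<open>\<epsilon>\<close> of its supremum. As \<open>H\<^sup>1\<close> embeds into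
  \<open>L\<^sup>\<infinity>\<close>, \<open>f\<close> is differentiable in time uniformly in space, so the supremum \<open>m\<close> satisfies
  \<open>m t \<le> m s + \<eta> (t - s)\<close> for \<open>s < t\<close> close to \<open>t\<close>, and is therefore nonincreasing.
  The same applies to \<open>-f\<close>.
\<close>

subsection \<open>Principal values of the kernel near a supremum\<close>

text \<open>Two obstacles shape the proof. The term
  \<open>a * \<alpha> / (\<alpha>\<^sup>2 + \<delta>\<^sup>2)\<close> behaves like a / \<alpha> at
  infinity, so a small slope does not make its integral over a half-line small: it grows like a
  logarithm. Only the symmetric truncation in the principal value removes this growth; what is left
  is of order |a| M^2 / \<alpha>^3, with M a bound for |F|. That remainder is useless near \<alpha>
  = 0, where the Lipschitz bound of F' controls the kernel directly; this is where three derivatives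
  enter. The second obstacle is that f and its derivatives are known only up to null sets,
  \<open>wderiv\<close> being an arbitrary choice among weak derivatives. A C^1 representative with
  Lipschitz derivative has to be extracted by means of test functions on both domains. The almost
  maximal points then form a nonempty open set, hence not a null set, so one of them satisfies the
  equation and the difference quotient bound. All constants may depend on t: a left estimate
  concerns a single time, and a compactness argument joins these estimates.\<close>

definition muskat_kernel :: "(real \<Rightarrow> real) \<Rightarrow> (real \<Rightarrow> real) \<Rightarrow> real \<Rightarrow> real \<Rightarrow> real" where
  "muskat_kernel F D x \<alpha> = (D x - D (x - \<alpha>)) * \<alpha> / (\<alpha>\<^sup>2 + (F x - F (x - \<alpha>))\<^sup>2)"

lemma lipschitz_imp_continuous_on:
  fixes D :: "real \<Rightarrow> real"
  assumes "\<And>x y. \<bar>D x - D y\<bar> \<le> K * \<bar>x - y\<bar>"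
  shows "continuous_on S D"
proof -
  have "K \<ge> 0" using assms[of 1 0] by (auto intro: order_trans[OF abs_ge_zero])
  then have "K-lipschitz_on S D"
    using assms by (intro lipschitz_onI) (auto simp: dist_real_def)
  then show ?thesis by (rule lipschitz_on_continuous_on)
qed

text \<open>The denominator is at least \<alpha>^2 and the numerator at most K \<alpha>^2. At
  \<alpha> = 0 the quotient is 0 by the convention for division. This controls the kernel near the
  origin.\<close>

lemma muskat_kernel_bound:
  assumes lip: "\<And>x y. \<bar>D x - D y\<bar> \<le> K * \<bar>x - y\<bar>"
  shows "\<bar>muskat_kernel F D x \<alpha>\<bar> \<le> K"
proof (cases "\<alpha> = 0")
  case True
  have "K \<ge> 0" using lip[of 1 0] by (auto intro: order_trans[OF abs_ge_zero])
  then show ?thesis using True by (simp add: muskat_kernel_def)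
next
  case False
  let ?q = "\<alpha>\<^sup>2 + (F x - F (x - \<alpha>))\<^sup>2"
  have q: "?q > 0" using False by (simp add: add_pos_nonneg)
  have K: "K \<ge> 0" using lip[of 1 0] by (auto intro: order_trans[OF abs_ge_zero])
  have "\<bar>(D x - D (x - \<alpha>)) * \<alpha>\<bar> \<le> (K * \<bar>\<alpha>\<bar>) * \<bar>\<alpha>\<bar>"
    unfolding abs_mult using lip[of x "x - \<alpha>"] by (intro mult_right_mono) auto
  also have "\<dots> = K * \<alpha>\<^sup>2" by (simp add: power2_eq_square)
  also have "\<dots> \<le> K * ?q" using K by (intro mult_left_mono) auto
  finally show ?thesis using q by (simp add: muskat_kernel_def abs_mult pos_divide_le_eq)
qed

lemma muskat_kernel_continuous:
  assumes F: "\<And>x. (F has_real_derivative D x) (at x)"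
    and lip: "\<And>x y. \<bar>D x - D y\<bar> \<le> K * \<bar>x - y\<bar>" and S: "0 \<notin> S"
  shows "continuous_on S (muskat_kernel F D x)"
proof -
  have cD: "continuous_on UNIV D" by (rule lipschitz_imp_continuous_on[OF lip])
  have cF: "continuous_on UNIV F"
    by (rule continuous_at_imp_continuous_on) (use F DERIV_isCont in blast)
  have 1: "continuous_on S (\<lambda>\<alpha>. D (x - \<alpha>))"
    by (rule continuous_on_compose2[OF cD]) (auto intro!: continuous_intros)
  have 2: "continuous_on S (\<lambda>\<alpha>. F (x - \<alpha>))"
    by (rule continuous_on_compose2[OF cF]) (auto intro!: continuous_intros)
  have "\<alpha>\<^sup>2 + (F x - F (x - \<alpha>))\<^sup>2 \<noteq> 0" if "\<alpha> \<in> S" for \<alpha>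
    using that S by (auto simp: sum_power2_eq_zero_iff)
  then show ?thesis unfolding muskat_kernel_def
    by (intro continuous_intros 1 2) auto
qed

text \<open>Since the derivative of \<open>arctan ((F x - F (x - \<alpha>)) / \<alpha>)\<close> is the part of the kernel that
  contains \<open>D (x - \<alpha>)\<close> up to a term that is nonnegative at a maximum, the kernel is dominated by
  the derivative of an explicit function. The logarithm is cancelled by the reflected half-line.\<close>

lemma muskat_kernel_integral_halfline:
  assumes F: "\<And>x. (F has_real_derivative D x) (at x)"
    and lip: "\<And>x y. \<bar>D x - D y\<bar> \<le> K * \<bar>x - y\<bar>"
    and M: "\<And>x. \<bar>F x\<bar> \<le> M" and \<epsilon>: "\<And>y. F y \<le> F x + \<epsilon>"
    and rR: "0 < r" "r \<le> R"
  shows "integral {r..R} (muskat_kernel F D x) \<le>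
    D x * (ln R - ln r) + 2 * M / R + \<bar>D x\<bar> + K * r + 2 * \<bar>D x\<bar> * M\<^sup>2 / r\<^sup>2 + \<epsilon> / r"
proof -
  define a where "a = D x"
  define \<delta> where "\<delta> \<alpha> = F x - F (x - \<alpha>)" for \<alpha>
  \<comment> \<open>A primitive of a majorant of the kernel: the exact arctan term;
    \<open>a * ln \<alpha>\<close> for a / \<alpha>; then primitives of 4 |a| M^2 / \<alpha>^3, the
    cost of replacing \<alpha> / (\<alpha>^2 + \<delta>^2) by 1 / \<alpha> when |\<delta>| \<le> 2
    M, and of \<epsilon> / \<alpha>^2, which uses - \<delta> \<le> \<epsilon>.\<close>
  define \<Phi> where "\<Phi> \<alpha> = - arctan (\<delta> \<alpha> / \<alpha>) + a * ln \<alpha> - 2 * \<bar>a\<bar> * M\<^sup>2 / \<alpha>\<^sup>2 - \<epsilon> / \<alpha>" for \<alpha>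
  define \<Phi>' where "\<Phi>' \<alpha> = - (D (x - \<alpha>) * \<alpha> - \<delta> \<alpha>) / (\<alpha>\<^sup>2 + (\<delta> \<alpha>)\<^sup>2)
    + a / \<alpha> + 4 * \<bar>a\<bar> * M\<^sup>2 / \<alpha>^3 + \<epsilon> / \<alpha>\<^sup>2" for \<alpha>
  have eps0: "\<epsilon> \<ge> 0" using \<epsilon>[of x] by simp
  have \<delta>M: "\<bar>\<delta> \<alpha>\<bar> \<le> 2 * M" for \<alpha>
    using M[of x] M[of "x - \<alpha>"] by (auto simp: \<delta>_def)
  have d\<delta>: "(\<delta> has_real_derivative D (x - \<alpha>)) (at \<alpha>)" for \<alpha>
    unfolding \<delta>_def by (auto intro!: derivative_eq_intros DERIV_chain2[OF F])
  have d\<Phi>: "(\<Phi> has_real_derivative \<Phi>' \<alpha>) (at \<alpha>)" if "\<alpha> > 0" for \<alpha>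
  proof -
    have q: "\<alpha>\<^sup>2 + (\<delta> \<alpha>)\<^sup>2 > 0" using that by (simp add: add_pos_nonneg)
    have 1: "((\<lambda>\<alpha>. arctan (\<delta> \<alpha> / \<alpha>)) has_real_derivative
        (D (x - \<alpha>) * \<alpha> - \<delta> \<alpha>) / (\<alpha>\<^sup>2 + (\<delta> \<alpha>)\<^sup>2)) (at \<alpha>)"
    proof -
      have "inverse (1 + (\<delta> \<alpha> / \<alpha>)\<^sup>2) * ((D (x - \<alpha>) * \<alpha> - \<delta> \<alpha> * 1) / (\<alpha> * \<alpha>)) =
        (D (x - \<alpha>) * \<alpha> - \<delta> \<alpha>) / (\<alpha>\<^sup>2 + (\<delta> \<alpha>)\<^sup>2)"
      proof -
        have "1 + (\<delta> \<alpha> / \<alpha>)\<^sup>2 = (\<alpha>\<^sup>2 + (\<delta> \<alpha>)\<^sup>2) / (\<alpha> * \<alpha>)"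
          using that by (simp add: field_simps power2_eq_square)
        then show ?thesis using that by simp
      qed
      then show ?thesis
        using DERIV_chain2[OF DERIV_arctan DERIV_divide[OF d\<delta> DERIV_ident], of \<alpha>] that
        by simp
    qed
    have 2: "((\<lambda>\<alpha>. a * ln \<alpha> - 2 * \<bar>a\<bar> * M\<^sup>2 / \<alpha>\<^sup>2 - \<epsilon> / \<alpha>) has_real_derivative
       a / \<alpha> + 4 * \<bar>a\<bar> * M\<^sup>2 / \<alpha>^3 + \<epsilon> / \<alpha>\<^sup>2) (at \<alpha>)"
      using that by (auto intro!: derivative_eq_intros simp: field_simps power2_eq_square power3_eq_cube)
    have 3: "\<Phi> = (\<lambda>\<alpha>. - arctan (\<delta> \<alpha> / \<alpha>) + (a * ln \<alpha> - 2 * \<bar>a\<bar> * M\<^sup>2 / \<alpha>\<^sup>2 - \<epsilon> / \<alpha>))"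
      by (auto simp: \<Phi>_def)
    show ?thesis unfolding 3 \<Phi>'_def
      using DERIV_add[OF DERIV_minus[OF 1] 2] by (simp add: minus_divide_left add.assoc)
  qed
  have le: "muskat_kernel F D x \<alpha> \<le> \<Phi>' \<alpha>" if "\<alpha> \<in> {r..R}" for \<alpha>
  proof -
    have pos: "\<alpha> > 0" using that rR by auto
    have q: "\<alpha>\<^sup>2 + (\<delta> \<alpha>)\<^sup>2 > 0" using pos by (simp add: add_pos_nonneg)
    have k: "muskat_kernel F D x \<alpha> = - (D (x - \<alpha>) * \<alpha> - \<delta> \<alpha>) / (\<alpha>\<^sup>2 + (\<delta> \<alpha>)\<^sup>2)
       + a * \<alpha> / (\<alpha>\<^sup>2 + (\<delta> \<alpha>)\<^sup>2) - \<delta> \<alpha> / (\<alpha>\<^sup>2 + (\<delta> \<alpha>)\<^sup>2)"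
      unfolding muskat_kernel_def a_def \<delta>_def[symmetric]
      by (simp add: add_divide_distrib[symmetric] diff_divide_distrib[symmetric] algebra_simps)
    have "- \<delta> \<alpha> \<le> \<epsilon>" using \<epsilon>[of "x - \<alpha>"] by (simp add: \<delta>_def)
    then have "- \<delta> \<alpha> / (\<alpha>\<^sup>2 + (\<delta> \<alpha>)\<^sup>2) \<le> \<epsilon> / (\<alpha>\<^sup>2 + (\<delta> \<alpha>)\<^sup>2)"
      using q by (intro divide_right_mono) auto
    also have "\<dots> \<le> \<epsilon> / \<alpha>\<^sup>2"
      using pos eps0 by (intro divide_left_mono) (auto simp: add_pos_nonneg)
    finally have 1: "- \<delta> \<alpha> / (\<alpha>\<^sup>2 + (\<delta> \<alpha>)\<^sup>2) \<le> \<epsilon> / \<alpha>\<^sup>2" .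
    have "a * \<alpha> / (\<alpha>\<^sup>2 + (\<delta> \<alpha>)\<^sup>2) - a / \<alpha> = - (a * (\<delta> \<alpha>)\<^sup>2) / (\<alpha> * (\<alpha>\<^sup>2 + (\<delta> \<alpha>)\<^sup>2))"
      using pos q by (simp add: field_simps power2_eq_square)
    also have "\<dots> \<le> \<bar>a\<bar> * (\<delta> \<alpha>)\<^sup>2 / (\<alpha> * (\<alpha>\<^sup>2 + (\<delta> \<alpha>)\<^sup>2))"
      using pos q by (intro divide_right_mono) (auto simp: abs_if mult_nonneg_nonneg)
    also have "\<dots> \<le> \<bar>a\<bar> * (2 * M)\<^sup>2 / (\<alpha> * \<alpha>\<^sup>2)"
      using pos q \<delta>M[of \<alpha>] by (intro frac_le mult_left_mono mult_nonneg_nonneg abs_le_square_iff[THEN iffD1]) auto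
    also have "\<dots> = 4 * \<bar>a\<bar> * M\<^sup>2 / \<alpha>^3"
      by (simp add: power2_eq_square power3_eq_cube ac_simps)
    finally show ?thesis using 1 unfolding k \<Phi>'_def by simp
  qed
  have I\<Phi>: "(\<Phi>' has_integral (\<Phi> R - \<Phi> r)) {r..R}"
    using rR by (intro fundamental_theorem_of_calculus)
      (auto intro!: has_field_derivative_at_within[OF d\<Phi>] simp: has_real_derivative_iff_has_vector_derivative[symmetric])
  have "muskat_kernel F D x integrable_on {r..R}"
    using rR by (intro integrable_continuous_real muskat_kernel_continuous[OF F lip]) auto
  then have "integral {r..R} (muskat_kernel F D x) \<le> \<Phi> R - \<Phi> r"
    using has_integral_le[OF integrable_integral I\<Phi>] le by blast
  \<comment> \<open>Both boundary terms use |arctan y| \<le> |y|: the crude bound pi / 2 would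
    neither vanish as R grows nor become small with r.\<close>
  moreover have "- arctan (\<delta> R / R) \<le> 2 * M / R"
  proof -
    have "- arctan (\<delta> R / R) \<le> \<bar>\<delta> R / R\<bar>" using abs_arctan_le[of "\<delta> R / R"] by simp
    also have "\<dots> \<le> 2 * M / R" using rR \<delta>M[of R] by (simp add: divide_right_mono)
    finally show ?thesis .
  qed
  \<comment> \<open>By the mean value theorem the quotient is a value of D within distance r of
    x.\<close>
  moreover have "arctan (\<delta> r / r) \<le> \<bar>a\<bar> + K * r"
  proof -
    obtain z where z: "0 < z" "z < r" "\<delta> r - \<delta> 0 = (r - 0) * D (x - z)"
      using MVT2[of 0 r \<delta> "\<lambda>\<alpha>. D (x - \<alpha>)"] rR d\<delta> by auto
    then have "\<delta> r / r = D (x - z)" using rR by (simp add: \<delta>_def)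
    moreover have "\<bar>D (x - z)\<bar> \<le> \<bar>a\<bar> + K * z" using lip[of "x - z" x] z by (simp add: a_def)
    moreover have "K * z \<le> K * r"
      using z lip[of 1 0] by (intro mult_left_mono) (auto intro: order_trans[OF abs_ge_zero])
    ultimately show ?thesis using abs_arctan_le[of "\<delta> r / r"] by linarith
  qed
  moreover have "2 * \<bar>a\<bar> * M\<^sup>2 / R\<^sup>2 \<ge> 0" "\<epsilon> / R \<ge> 0" using rR eps0 by auto
  ultimately show ?thesis unfolding \<Phi>_def a_def[symmetric] right_diff_distrib by linarith
qed

text \<open>Reflection turns the negative half-line at x into the positive one at -x. The slope
  there is \<open>- D x\<close>, so the logarithms of the two half-line estimates cancel over a
  symmetric interval.\<close>

lemma muskat_kernel_reflect:
  "muskat_kernel (\<lambda>y. F (- y)) (\<lambda>y. - D (- y)) (- x) \<alpha> = muskat_kernel F D x (- \<alpha>)"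
  by (simp add: muskat_kernel_def algebra_simps)

text \<open>The half-line estimate is applied to F and to its reflection, and the uniform kernel
  bound to the gap [-r, r]. In 4 K r, the gap contributes 2 K r and each half-line K r.\<close>

lemma muskat_kernel_integral_bound:
  assumes F: "\<And>x. (F has_real_derivative D x) (at x)"
    and lip: "\<And>x y. \<bar>D x - D y\<bar> \<le> K * \<bar>x - y\<bar>"
    and M: "\<And>x. \<bar>F x\<bar> \<le> M" and \<epsilon>: "\<And>y. F y \<le> F x + \<epsilon>"
    and rR: "0 < r" "r \<le> R"
    and int: "muskat_kernel F D x integrable_on {-R..R}"
  shows "integral {-R..R} (muskat_kernel F D x) \<le>
    4 * M / R + 2 * \<bar>D x\<bar> + 4 * K * r + 4 * \<bar>D x\<bar> * M\<^sup>2 / r\<^sup>2 + 2 * \<epsilon> / r"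
proof -
  let ?h = "muskat_kernel F D x"
  let ?F = "\<lambda>y. F (- y)" and ?D = "\<lambda>y. - D (- y)"
  have F': "(?F has_real_derivative ?D y) (at y)" for y
    using DERIV_mirror F by blast
  have lip': "\<bar>?D y - ?D z\<bar> \<le> K * \<bar>y - z\<bar>" for y z using lip[of "-y" "-z"]
    by (simp add: abs_minus_commute)
  have "integral {r..R} (muskat_kernel ?F ?D (- x)) \<le>
     ?D (- x) * (ln R - ln r) + 2 * M / R + \<bar>?D (- x)\<bar> + K * r + 2 * \<bar>?D (- x)\<bar> * M\<^sup>2 / r\<^sup>2 + \<epsilon> / r"
    by (rule muskat_kernel_integral_halfline[OF F' lip']) (use M \<epsilon> rR in auto)
  moreover have "integral {r..R} (muskat_kernel ?F ?D (- x)) = integral {-R..-r} ?h"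
    using Henstock_Kurzweil_Integration.integral_reflect_real[of R r "\<lambda>\<alpha>. ?h (-\<alpha>)"]
    by (simp add: muskat_kernel_reflect[abs_def])
  moreover have "integral {-r..r} ?h \<le> 2 * K * r"
  proof -
    have "integral {-r..r} ?h \<le> integral {-r..r} (\<lambda>_. K)"
      using rR muskat_kernel_bound[OF lip, of F x]
      by (intro integral_le integrable_on_subinterval[OF int]) (auto simp: abs_le_iff)
    then show ?thesis using rR by (simp add: algebra_simps)
  qed
  moreover have "integral {-R..R} ?h = integral {-R..-r} ?h + integral {-r..r} ?h + integral {r..R} ?h"
  proof -
    have "integral {-R..-r} ?h + integral {-r..R} ?h = integral {-R..R} ?h"
      by (rule Henstock_Kurzweil_Integration.integral_combine[OF _ _ int]) (use rR in auto)
    moreover have "integral {-r..r} ?h + integral {r..R} ?h = integral {-r..R} ?h"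
      by (rule Henstock_Kurzweil_Integration.integral_combine)
        (use rR in \<open>auto intro: integrable_on_subinterval[OF int]\<close>)
    ultimately show ?thesis by simp
  qed
  moreover note muskat_kernel_integral_halfline[OF F lip M \<epsilon> rR]
  moreover have "4 * M / R = 2 * (2 * M / R)" "2 * \<epsilon> / r = 2 * (\<epsilon> / r)"
    "4 * \<bar>D x\<bar> * M\<^sup>2 / r\<^sup>2 = 2 * (2 * \<bar>D x\<bar> * M\<^sup>2 / r\<^sup>2)" by simp_all
  ultimately show ?thesis by (simp add: mult_minus_left del: times_divide_eq_right)
qed

text \<open>A step of length s raises F by at most \<epsilon>, so the mean slope along it is at most
  \<epsilon> / s. The Lipschitz bound carries this slope back to x at the cost K s. Steps to both
  sides give both signs.\<close>

lemma derivative_small_near_supremum: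
  assumes F: "\<And>x. (F has_real_derivative D x) (at x)"
    and lip: "\<And>x y. \<bar>D x - D y\<bar> \<le> K * \<bar>x - y\<bar>"
    and \<epsilon>: "\<And>y. F y \<le> F x + \<epsilon>" and s: "s > 0"
  shows "\<bar>D x\<bar> \<le> \<epsilon> / s + K * s"
proof -
  have K: "K * z \<le> K * s" if "z \<le> s" for z
    using that lip[of 1 0] by (intro mult_left_mono) (auto intro: order_trans[OF abs_ge_zero])
  obtain z where z: "x < z" "z < x + s" "F (x + s) - F x = s * D z"
    using MVT2[of x "x + s" F D] s F by auto
  have "s * D z \<le> \<epsilon>" using \<epsilon>[of "x + s"] z by simp
  then have "D z \<le> \<epsilon> / s" using s by (simp add: field_simps)
  then have 1: "D x \<le> \<epsilon> / s + K * s" using lip[of x z] z K[of "z - x"] by auto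
  obtain y where y: "x - s < y" "y < x" "F x - F (x - s) = s * D y"
    using MVT2[of "x - s" x F D] s F by auto
  have "- (s * D y) \<le> \<epsilon>" using \<epsilon>[of "x - s"] y by simp
  then have "- D y \<le> \<epsilon> / s" using s by (simp add: field_simps)
  then have 2: "- D x \<le> \<epsilon> / s + K * s" using lip[of x y] y K[of "x - y"] by auto
  show ?thesis using 1 2 by simp
qed

text \<open>Only the term 4 M / R depends on R, and it disappears in the limit. The radius r stays
  free, to be balanced against \<epsilon> afterwards.\<close>

lemma has_PV_muskat_kernel_bound:
  assumes F: "\<And>x. (F has_real_derivative D x) (at x)"
    and lip: "\<And>x y. \<bar>D x - D y\<bar> \<le> K * \<bar>x - y\<bar>"
    and M: "\<And>x. \<bar>F x\<bar> \<le> M" and \<epsilon>: "\<And>y. F y \<le> F x + \<epsilon>"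
    and r: "0 < r" and c: "c > 0" and PV: "has_PV (\<lambda>\<alpha>. c * muskat_kernel F D x \<alpha>) L"
  shows "L \<le> c * (2 * \<bar>D x\<bar> + 4 * K * r + 4 * \<bar>D x\<bar> * M\<^sup>2 / r\<^sup>2 + 2 * \<epsilon> / r)"
proof (rule tendsto_le)
  let ?B = "2 * \<bar>D x\<bar> + 4 * K * r + 4 * \<bar>D x\<bar> * M\<^sup>2 / r\<^sup>2 + 2 * \<epsilon> / r"
  show "((\<lambda>R. set_lebesgue_integral lborel {-R..R} (\<lambda>\<alpha>. c * muskat_kernel F D x \<alpha>)) \<longlongrightarrow> L) at_top"
    using PV by (simp add: has_PV_def)
  have "((\<lambda>R. c * (4 * M / R + ?B)) \<longlongrightarrow> c * (0 + ?B)) at_top"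
    by (intro tendsto_intros real_tendsto_divide_at_top[OF tendsto_const] filterlim_ident)
  then show "((\<lambda>R. c * (4 * M / R + ?B)) \<longlongrightarrow> c * ?B) at_top" by simp
  show "\<forall>\<^sub>F R in at_top. set_lebesgue_integral lborel {-R..R} (\<lambda>\<alpha>. c * muskat_kernel F D x \<alpha>)
      \<le> c * (4 * M / R + ?B)"
    using eventually_ge_at_top[of r]
  proof eventually_elim
    case (elim R)
    have "set_integrable lborel {-R..R} (\<lambda>\<alpha>. c * muskat_kernel F D x \<alpha>)"
      using PV by (simp add: has_PV_def)
    then have int: "set_integrable lborel {-R..R} (muskat_kernel F D x)"
      using c by simp
    have "set_lebesgue_integral lborel {-R..R} (\<lambda>\<alpha>. c * muskat_kernel F D x \<alpha>)
        = c * integral {-R..R} (muskat_kernel F D x)"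
      using set_borel_integral_eq_integral(2)[OF int] by simp
    also have "\<dots> \<le> c * (4 * M / R + 2 * \<bar>D x\<bar> + 4 * K * r + 4 * \<bar>D x\<bar> * M\<^sup>2 / r\<^sup>2 + 2 * \<epsilon> / r)"
      using c set_borel_integral_eq_integral(1)[OF int] elim r
      by (intro mult_left_mono muskat_kernel_integral_bound[OF F lip M \<epsilon>]) auto
    finally show ?case by (simp add: add.assoc)
  qed
qed simp

text \<open>The choice \<open>s = \<epsilon> powr (1/2)\<close>, \<open>r = \<epsilon> powr (1/8)\<close> makes all error terms vanish with \<open>\<epsilon>\<close>.\<close>

lemma muskat_velocity_small_near_supremum:
  assumes F: "\<And>x. (F has_real_derivative D x) (at x)"
    and lip: "\<And>x y. \<bar>D x - D y\<bar> \<le> K * \<bar>x - y\<bar>"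
    and M: "\<And>x. \<bar>F x\<bar> \<le> M" and c: "c > 0" and \<eta>: "\<eta> > 0"
  obtains \<epsilon> where "\<epsilon> > 0"
    "\<And>x L. (\<And>y. F y \<le> F x + \<epsilon>) \<Longrightarrow> has_PV (\<lambda>\<alpha>. c * muskat_kernel F D x \<alpha>) L \<Longrightarrow> L \<le> \<eta>"
proof -
  \<comment> \<open>Here \<epsilon> = z^8, s = z^4 and r = z, which keeps every exponent integral.
    \<open>A z\<close> bounds |D x|; its factor z^4 absorbs the division by r^2, and \<epsilon> / r
    is z^7. Hence \<open>B\<close> is a polynomial with \<open>B 0 = 0\<close>.\<close>
  define A where "A z = (1 + K) * z^4" for z :: real
  define B where "B z = c * (2 * A z + 4 * K * z + 4 * (1 + K) * z\<^sup>2 * M\<^sup>2 + 2 * z^7)" for z :: real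
  have "(B \<longlongrightarrow> B 0) (at_right 0)" unfolding B_def A_def by (intro tendsto_intros)
  then have "\<forall>\<^sub>F z in at_right 0. B z < \<eta>"
    by (rule order_tendstoD(2)) (use \<eta> in \<open>simp add: B_def A_def\<close>)
  then have "\<forall>\<^sub>F z in at_right 0. B z < \<eta> \<and> z > 0"
    using eventually_at_right_less[of 0] by (rule eventually_conj)
  then obtain z where z: "B z < \<eta>" "z > 0"
    using eventually_happens trivial_limit_at_right_real by blast
  show ?thesis
  proof (rule that[of "z^8"])
    show "z^8 > 0" using z by simp
    fix x L assume \<epsilon>: "\<And>y. F y \<le> F x + z^8" and PV: "has_PV (\<lambda>\<alpha>. c * muskat_kernel F D x \<alpha>) L"
    have "\<bar>D x\<bar> \<le> z^8 / z^4 + K * z^4"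
      using z by (intro derivative_small_near_supremum[OF F lip \<epsilon>]) auto
    also have "\<dots> = A z" using z by (simp add: A_def field_simps power_add[symmetric])
    finally have a: "\<bar>D x\<bar> \<le> A z" .
    have "L \<le> c * (2 * \<bar>D x\<bar> + 4 * K * z + 4 * \<bar>D x\<bar> * M\<^sup>2 / z\<^sup>2 + 2 * z^8 / z)"
      by (rule has_PV_muskat_kernel_bound[OF F lip M \<epsilon> z(2) c PV])
    also have "\<dots> \<le> c * (2 * A z + 4 * K * z + 4 * A z * M\<^sup>2 / z\<^sup>2 + 2 * z^8 / z)"
      using c a by (intro mult_left_mono add_mono divide_right_mono mult_right_mono order_refl) auto
    also have "\<dots> = B z"
      using z by (simp add: B_def A_def power_numeral_reduce)
    finally show "L \<le> \<eta>" using z by simp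
  qed
qed

subsection \<open>Evolution of the supremum\<close>

text \<open>The length of a left step has no lower bound, so steps cannot simply be iterated.
  Instead, for fixed \<eta>, the times at which m s - \<eta> s is at least its value at t form a
  compact set. Its least element is 0, since a left step from a positive one would produce a smaller
  element. Finally \<eta> tends to 0.\<close>

lemma nonincreasing_from_left_estimates:
  fixes m :: "real \<Rightarrow> real"
  assumes cont: "continuous_on {0..T} m"
    and left: "\<And>t \<eta>. 0 < t \<Longrightarrow> t \<le> T \<Longrightarrow> \<eta> > 0 \<Longrightarrow> \<exists>s\<in>{0..<t}. m t \<le> m s + \<eta> * (t - s)"
    and t: "t \<in> {0..T}"
  shows "m t \<le> m 0"
proof -
  have "m t \<le> m 0 + \<eta> * t" if \<eta>: "\<eta> > 0" for \<eta>
  proof -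
    define g where "g s = m s - \<eta> * s" for s
    define S where "S = {0..t} \<inter> g -` {g t..}"
    have "continuous_on {0..t} g" unfolding g_def
      using t by (intro continuous_intros continuous_on_subset[OF cont]) auto
    then have "closed S" unfolding S_def by (intro continuous_closed_preimage) auto
    moreover have "bounded S" unfolding S_def by (rule bounded_subset[of "{0..t}"]) auto
    moreover have "t \<in> S" using t by (auto simp: S_def)
    ultimately obtain s0 where s0: "s0 \<in> S" "\<And>s. s \<in> S \<Longrightarrow> s0 \<le> s"
      using compact_attains_inf[of S] by (auto simp: compact_eq_bounded_closed)
    have "s0 = 0"
    proof (rule ccontr)
      assume "s0 \<noteq> 0"
      then obtain s where s: "s \<in> {0..<s0}" "m s0 \<le> m s + \<eta> * (s0 - s)"
        using left[of s0 \<eta>] s0(1) t \<eta> by (auto simp: S_def)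
      then have "g s0 \<le> g s" by (simp add: g_def algebra_simps)
      then have "s \<in> S" using s s0(1) by (auto simp: S_def)
      then show False using s0(2)[of s] s by auto
    qed
    then show ?thesis using s0(1) by (auto simp: S_def g_def)
  qed
  note * = this
  have "m t \<le> m 0 + e" if "e > 0" for e
  proof (cases "t = 0")
    case False
    then have "t > 0" using t by auto
    then show ?thesis using *[of "e / t"] \<open>e > 0\<close> by simp
  qed (use that in simp)
  then show ?thesis by (rule field_le_epsilon)
qed

text \<open>A nonempty open set is not Lebesgue null. Thus an almost maximal point can be chosen at
  which statements known almost everywhere hold as well.\<close>

lemma AE_lborel_open_witness:
  fixes U :: "real set"
  assumes "open U" "U \<noteq> {}" "AE x in lborel. P x"
  obtains x where "x \<in> U" "P x"
proof -
  obtain N where N: "{x \<in> space lborel. \<not> P x} \<subseteq> N" "N \<in> null_sets lborel"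
    using assms(3) by (auto simp: eventually_ae_filter)
  then have "negligible N" by (simp add: negligible_iff_null_sets null_sets_completionI)
  then have "\<not> U \<subseteq> N" using open_not_negligible[OF assms(1,2)] negligible_subset by blast
  then show ?thesis using N(1) that by auto
qed

lemma continuous_le_if_AE_le:
  fixes F :: "real \<Rightarrow> real"
  assumes F: "continuous_on UNIV F" and G: "continuous_on UNIV G" and le: "AE x in lborel. F x \<le> G x"
  shows "F x \<le> G x"
proof (rule ccontr)
  assume "\<not> F x \<le> G x"
  then have "{x. G x < F x} \<noteq> {}" by (metis (mono_tags) empty_iff mem_Collect_eq not_le)
  with open_Collect_less[OF G F] obtain y where "y \<in> {x. G x < F x}" "F y \<le> G y"
    using AE_lborel_open_witness[OF _ _ le] by blast
  then show False by simp
qed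

text \<open>The maximum principle separated from Sobolev theory: \<open>F t\<close> is the regular
  representative, \<open>G t\<close> the velocity, known only almost everywhere. The exceptional
  null set in the difference quotient bound may depend on s, which is harmless because the argument
  uses one s at a time. The one-sided form is applied to the solution and to its negative.\<close>

theorem muskat_supremum_nonincreasing:
  fixes F D G :: "real \<Rightarrow> real \<Rightarrow> real"
  assumes c: "c > 0"
    and F: "\<And>t x. t \<in> {0..T} \<Longrightarrow> (F t has_real_derivative D t x) (at x)"
    and bdd: "\<And>t. t \<in> {0..T} \<Longrightarrow> \<exists>M. \<forall>x. \<bar>F t x\<bar> \<le> M"
    and lip: "\<And>t. t \<in> {0..T} \<Longrightarrow> \<exists>K. \<forall>x y. \<bar>D t x - D t y\<bar> \<le> K * \<bar>x - y\<bar>"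
    and PV: "\<And>t. t \<in> {0..T} \<Longrightarrow>
      AE x in lborel. has_PV (\<lambda>\<alpha>. c * muskat_kernel (F t) (D t) x \<alpha>) (G t x)"
    and G: "\<And>t. t \<in> {0..T} \<Longrightarrow> \<exists>B. AE x in lborel. \<bar>G t x\<bar> \<le> B"
    and diff: "\<And>t e. t \<in> {0..T} \<Longrightarrow> e > 0 \<Longrightarrow> \<forall>\<^sub>F s in at t within {0..T}.
      AE x in lborel. \<bar>(F s x - F t x) / (s - t) - G t x\<bar> \<le> e"
    and N: "\<And>x. F 0 x \<le> N" and t: "t \<in> {0..T}"
  shows "F t x \<le> N"
proof -
  define m where "m t = (SUP x. F t x)" for t
  have cF: "continuous_on UNIV (F t)" if "t \<in> {0..T}" for t
    by (rule continuous_at_imp_continuous_on) (use F[OF that] DERIV_isCont in blast)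
  have bdda: "bdd_above (range (F t))" if t: "t \<in> {0..T}" for t
  proof -
    obtain M where "\<And>x. \<bar>F t x\<bar> \<le> M" using bdd[OF t] by auto
    then show ?thesis by (intro bdd_aboveI[of _ M]) (auto simp: abs_le_iff)
  qed
  have Fm: "F t x \<le> m t" if "t \<in> {0..T}" for t x
    unfolding m_def by (rule cSUP_upper[OF _ bdda[OF that]]) auto
  have mle: "m t \<le> B" if "\<And>x. F t x \<le> B" for t B
    unfolding m_def by (rule cSUP_least) (use that in auto)
  have "m t \<le> m 0"
  proof (rule nonincreasing_from_left_estimates[OF _ _ t])
    show "continuous_on {0..T} m" unfolding continuous_on_def
    proof (intro ballI)
      fix t assume t: "t \<in> {0..T}"
      \<comment> \<open>With tolerance 1 the difference quotients are bounded by
        \<open>B + 1\<close>, so suprema at times s and t differ by at most (B + 1) |s - t|.\<close>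
      obtain B where B: "AE x in lborel. \<bar>G t x\<bar> \<le> B" using G[OF t] by auto
      have "\<forall>\<^sub>F s in at t within {0..T}. \<bar>m s - m t\<bar> \<le> \<bar>s - t\<bar> * (B + 1)"
      proof (rule eventually_elim2[OF diff[OF t zero_less_one]])
        show "\<forall>\<^sub>F s in at t within {0..T}. s \<noteq> t \<and> s \<in> {0..T}"
          by (simp add: eventually_at_filter)
        fix s assume ae: "AE x in lborel. \<bar>(F s x - F t x) / (s - t) - G t x\<bar> \<le> 1"
          and s: "s \<noteq> t \<and> s \<in> {0..T}"
        have "AE x in lborel. \<bar>F s x - F t x\<bar> \<le> \<bar>s - t\<bar> * (B + 1)"
          using ae B
        proof eventually_elim
          case (elim x)
          then have "\<bar>F s x - F t x\<bar> / \<bar>s - t\<bar> \<le> B + 1" unfolding abs_divide[symmetric] by linarith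
          then show ?case using s by (simp add: pos_divide_le_eq mult.commute)
        qed
        then have 1: "AE x in lborel. F s x \<le> F t x + \<bar>s - t\<bar> * (B + 1)"
            and 2: "AE x in lborel. F t x \<le> F s x + \<bar>s - t\<bar> * (B + 1)"
          by (eventually_elim, linarith)+
        have "F s x \<le> F t x + \<bar>s - t\<bar> * (B + 1)" for x
          by (rule continuous_le_if_AE_le[OF _ _ 1]) (use s t cF in \<open>auto intro!: continuous_intros\<close>)
        moreover have "F t x \<le> F s x + \<bar>s - t\<bar> * (B + 1)" for x
          by (rule continuous_le_if_AE_le[OF _ _ 2]) (use s t cF in \<open>auto intro!: continuous_intros\<close>)
        ultimately have "m s \<le> m t + \<bar>s - t\<bar> * (B + 1)" "m t \<le> m s + \<bar>s - t\<bar> * (B + 1)"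
          using s t by (meson mle Fm add_right_mono order_trans)+
        then show "\<bar>m s - m t\<bar> \<le> \<bar>s - t\<bar> * (B + 1)" by (simp add: abs_le_iff)
      qed
      moreover have "((\<lambda>s. \<bar>s - t\<bar> * (B + 1)) \<longlongrightarrow> \<bar>t - t\<bar> * (B + 1)) (at t within {0..T})"
        by (intro tendsto_intros)
      ultimately show "(m \<longlongrightarrow> m t) (at t within {0..T})"
        using LIM_zero_cancel[OF Lim_null_comparison[of "\<lambda>s. m s - m t"]] by simp
    qed
  next
    fix t \<eta> :: real assume "0 < t" "t \<le> T" and \<eta>: "\<eta> > 0"
    then have t: "t \<in> {0..T}" by auto
    obtain M where M: "\<And>x. \<bar>F t x\<bar> \<le> M" using bdd[OF t] by auto
    obtain K where K: "\<And>x y. \<bar>D t x - D t y\<bar> \<le> K * \<bar>x - y\<bar>" using lip[OF t] by auto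
    obtain \<epsilon> where \<epsilon>: "\<epsilon> > 0" "\<And>x L. (\<And>y. F t y \<le> F t x + \<epsilon>) \<Longrightarrow>
        has_PV (\<lambda>\<alpha>. c * muskat_kernel (F t) (D t) x \<alpha>) L \<Longrightarrow> L \<le> \<eta> / 2"
      using muskat_velocity_small_near_supremum[OF F[OF t] K M c, of "\<eta> / 2"] \<eta> by auto
    obtain d where d: "d > 0" "\<And>s. s \<in> {0..T} \<Longrightarrow> s \<noteq> t \<Longrightarrow> dist s t < d \<Longrightarrow>
        AE x in lborel. \<bar>(F s x - F t x) / (s - t) - G t x\<bar> \<le> \<eta> / 2"
      using diff[OF t, of "\<eta> / 2"] \<eta> unfolding eventually_at by auto
    \<comment> \<open>A time strictly before t, within the range of the difference quotient bound,
      and not before the initial time.\<close>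
    define s where "s = max 0 (t - d / 2)"
    have s: "s \<in> {0..<t}" using \<open>0 < t\<close> d by (auto simp: s_def)
    then have ae: "AE x in lborel. \<bar>(F s x - F t x) / (s - t) - G t x\<bar> \<le> \<eta> / 2"
      using t d(1) by (intro d(2)) (auto simp: dist_real_def s_def)
    have sT: "s \<in> {0..T}" using s t by auto
    \<comment> \<open>The time s is already fixed. The point x is chosen within
      \<open>min e \<epsilon>\<close> of the supremum: \<epsilon> makes the velocity at most \<eta>
      / 2, while e is the error that can still be sent to 0. The other \<eta> / 2 is the difference
      quotient error.\<close>
    have "m t \<le> m s + \<eta> * (t - s) + e" if e: "e > 0" for e
    proof -
      have "\<exists>y. m t - min e \<epsilon> < F t y"
        using less_cSUP_iff[OF _ bdda[OF t], of "m t - min e \<epsilon>"] e \<epsilon>(1) by (auto simp: m_def)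
      moreover have "open {y. m t - min e \<epsilon> < F t y}"
        by (intro open_Collect_less continuous_intros cF t)
      ultimately obtain x where x: "m t - min e \<epsilon> < F t x"
          "has_PV (\<lambda>\<alpha>. c * muskat_kernel (F t) (D t) x \<alpha>) (G t x)"
          "\<bar>(F s x - F t x) / (s - t) - G t x\<bar> \<le> \<eta> / 2"
        using AE_lborel_open_witness[of "{y. m t - min e \<epsilon> < F t y}"
           "\<lambda>x. has_PV (\<lambda>\<alpha>. c * muskat_kernel (F t) (D t) x \<alpha>) (G t x) \<and>
                \<bar>(F s x - F t x) / (s - t) - G t x\<bar> \<le> \<eta> / 2"] PV[OF t] ae by auto
      have "F t y \<le> F t x + \<epsilon>" for y using Fm[OF t, of y] x(1) by linarith
      then have "G t x \<le> \<eta> / 2" using \<epsilon>(2) x(2) by blast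
      then have "(F s x - F t x) / (s - t) \<le> \<eta>" using x(3) by linarith
      then have "F t x - F s x \<le> \<eta> * (t - s)" using s by (simp add: divide_simps algebra_simps)
      then show ?thesis using x(1) Fm[OF sT, of x] by linarith
    qed
    then have "m t \<le> m s + \<eta> * (t - s)" by (rule field_le_epsilon)
    then show "\<exists>s\<in>{0..<t}. m t \<le> m s + \<eta> * (t - s)" using s by auto
  qed
  also have "m 0 \<le> N" by (rule mle[OF N])
  finally show ?thesis using Fm[OF t, of x] by linarith
qed

subsection \<open>Smooth bump functions\<close>

text \<open>Smoothness is layered by order so that closure under products and compositions goes by
  induction: the derivative of a product at one level involves only factors of the level
  below.\<close>

primrec times_differentiable :: "nat \<Rightarrow> (real \<Rightarrow> real) \<Rightarrow> bool" where
  "times_differentiable 0 f = True"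
| "times_differentiable (Suc n) f = ((\<forall>x. f differentiable (at x)) \<and> times_differentiable n (deriv f))"

lemma times_differentiable_iff:
  "times_differentiable n f \<longleftrightarrow> (\<forall>m<n. \<forall>x. (deriv ^^ m) f differentiable (at x))"
proof (induction n arbitrary: f)
  case (Suc n)
  show ?case
    unfolding times_differentiable.simps Suc.IH
    by (simp add: All_less_Suc2 funpow_swap1)
qed simp

lemma smooth_fun_iff: "smooth_fun f \<longleftrightarrow> (\<forall>n. times_differentiable n f)"
  unfolding smooth_fun_def times_differentiable_iff by blast

lemma times_differentiable_SucI:
  assumes "\<And>x. (f has_real_derivative f' x) (at x)" "times_differentiable n f'"
  shows "times_differentiable (Suc n) f"
proof -
  have "deriv f = f'" using assms(1) DERIV_imp_deriv by blast
  moreover have "f differentiable (at x)" for x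
    using assms(1) real_differentiable_def by blast
  ultimately show ?thesis using assms(2) by simp
qed

lemma times_differentiable_SucD:
  assumes "times_differentiable (Suc n) f"
  shows "(f has_real_derivative deriv f x) (at x)" "times_differentiable n (deriv f)"
  using assms by (auto simp: DERIV_deriv_iff_real_differentiable)

lemma times_differentiable_Suc_imp: "times_differentiable (Suc n) f \<Longrightarrow> times_differentiable n f"
  by (auto simp: times_differentiable_iff)

lemma times_differentiable_const: "times_differentiable n (\<lambda>x. c)"
  by (induction n arbitrary: c) auto

lemma times_differentiable_id: "times_differentiable n (\<lambda>x. x)"
proof (cases n)
  case (Suc m)
  then show ?thesis by (simp add: times_differentiable_const)
qed simp

lemma times_differentiable_add:
  "times_differentiable n f \<Longrightarrow> times_differentiable n g \<Longrightarrow> times_differentiable n (\<lambda>x. f x + g x)"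
proof (induction n arbitrary: f g)
  case (Suc n)
  show ?case
    by (rule times_differentiable_SucI[OF DERIV_add[OF Suc.prems[THEN times_differentiable_SucD(1)]]])
      (intro Suc.IH Suc.prems[THEN times_differentiable_SucD(2)])
qed simp

lemma times_differentiable_mult:
  "times_differentiable n f \<Longrightarrow> times_differentiable n g \<Longrightarrow> times_differentiable n (\<lambda>x. f x * g x)"
proof (induction n arbitrary: f g)
  case (Suc n)
  show ?case
    by (rule times_differentiable_SucI[OF DERIV_mult[OF Suc.prems[THEN times_differentiable_SucD(1)]]])
      (intro times_differentiable_add Suc.IH Suc.prems[THEN times_differentiable_SucD(2)]
        Suc.prems[THEN times_differentiable_Suc_imp])
qed simp

lemma smooth_fun_deriv: "smooth_fun f \<Longrightarrow> (f has_real_derivative deriv f x) (at x)"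
  using times_differentiable_SucD(1) unfolding smooth_fun_iff by blast

lemma smooth_fun_deriv_smooth: "smooth_fun f \<Longrightarrow> smooth_fun (deriv f)"
  using times_differentiable_SucD(2) unfolding smooth_fun_iff by blast

lemma smooth_funI:
  assumes "\<And>x. (f has_real_derivative f' x) (at x)" "smooth_fun f'"
  shows "smooth_fun f"
  unfolding smooth_fun_iff
proof
  fix n show "times_differentiable n f"
    using times_differentiable_SucI[OF assms(1), of n] times_differentiable_Suc_imp assms(2)
    unfolding smooth_fun_iff by blast
qed

lemma smooth_fun_add: "smooth_fun f \<Longrightarrow> smooth_fun g \<Longrightarrow> smooth_fun (\<lambda>x. f x + g x)"
  and smooth_fun_mult: "smooth_fun f \<Longrightarrow> smooth_fun g \<Longrightarrow> smooth_fun (\<lambda>x. f x * g x)"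
  and smooth_fun_const: "smooth_fun (\<lambda>x. c)"
  and smooth_fun_id: "smooth_fun (\<lambda>x. x)"
  by (simp_all add: smooth_fun_iff times_differentiable_add times_differentiable_mult
      times_differentiable_const times_differentiable_id)

lemma smooth_fun_cos: "smooth_fun (\<lambda>x. cos (x - m))"
proof -
  \<comment> \<open>The span of the shifted cosine and sine is closed under differentiation, so the
    induction runs over all coefficients.\<close>
  have "times_differentiable n (\<lambda>x. cos (x - m) * a + sin (x - m) * b)" for n a b
  proof (induction n arbitrary: a b)
    case (Suc n)
    have "((\<lambda>x. cos (x - m) * a + sin (x - m) * b) has_real_derivative
        cos (x - m) * b + sin (x - m) * (- a)) (at x)" for x
      by (auto intro!: derivative_eq_intros)
    then show ?case by (rule times_differentiable_SucI) (rule Suc.IH)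
  qed simp
  from this[of _ 1 0] show ?thesis by (simp add: smooth_fun_iff)
qed

lemma smooth_fun_continuous: "smooth_fun f \<Longrightarrow> continuous_on S f"
  using smooth_fun_deriv DERIV_isCont by (blast intro: continuous_at_imp_continuous_on)

text \<open>Polynomials in 1 / x times the flat function exp (- 1 / x). This family is closed under
  differentiation, with p replaced by X^2 (p - p'), so a single differentiability lemma gives all
  orders. The case p = 1 is the classical building block of bump functions.\<close>

definition flat_exp :: "real poly \<Rightarrow> real \<Rightarrow> real" where
  "flat_exp p x = (if x > 0 then poly p (1 / x) * exp (- 1 / x) else 0)"

lemma poly_over_exp_tendsto_0: "((\<lambda>y. poly p y / exp y) \<longlongrightarrow> (0::real)) at_top"
proof -
  have "((\<lambda>y. \<Sum>i\<le>degree p. coeff p i * (y ^ i / exp y)) \<longlongrightarrow> (\<Sum>i\<le>degree p. coeff p i * 0)) at_top"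
    by (intro tendsto_intros tendsto_power_div_exp_0)
  then show ?thesis by (simp add: poly_altdef sum_divide_distrib)
qed

lemma DERIV_flat_exp:
  "(flat_exp p has_real_derivative flat_exp ([:0, 0, 1:] * (p - pderiv p)) x) (at x)"
proof -
  consider "x > 0" | "x < 0" | "x = 0" by linarith
  then show ?thesis
  proof cases
    case 1
    have "((\<lambda>x. poly p (1 / x) * exp (- 1 / x)) has_real_derivative
        flat_exp ([:0, 0, 1:] * (p - pderiv p)) x) (at x)"
      using 1 by (auto intro!: derivative_eq_intros DERIV_chain2[OF poly_DERIV]
          simp: flat_exp_def field_simps power2_eq_square)
    then show ?thesis
      by (rule has_field_derivative_transform_within_open[of _ _ _ "{0<..}"]) (use 1 in \<open>auto simp: flat_exp_def\<close>)
  next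
    case 2
    have "((\<lambda>x. 0) has_real_derivative flat_exp ([:0, 0, 1:] * (p - pderiv p)) x) (at x)"
      using 2 by (simp add: flat_exp_def)
    then show ?thesis
      by (rule has_field_derivative_transform_within_open[of _ _ _ "{..<0}"]) (use 2 in \<open>auto simp: flat_exp_def\<close>)
  next
    case 3
    \<comment> \<open>With y = 1 / h the quotient becomes y p(y) / exp y, where
      \<open>pCons 0 p\<close> supplies the additional factor y; the exponential wins.\<close>
    have "((\<lambda>h. flat_exp p h / h) \<longlongrightarrow> 0) (at_right 0)"
    proof (rule Lim_transform_eventually)
      show "((\<lambda>h. poly (pCons 0 p) (inverse h) / exp (inverse h)) \<longlongrightarrow> 0) (at_right 0)"
        by (rule filterlim_compose[OF poly_over_exp_tendsto_0 filterlim_inverse_at_top_right])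
      show "\<forall>\<^sub>F h in at_right 0. poly (pCons 0 p) (inverse h) / exp (inverse h) = flat_exp p h / h"
        using eventually_at_right_less[of 0]
        by eventually_elim (simp add: flat_exp_def exp_minus field_simps)
    qed
    moreover have "((\<lambda>h. flat_exp p h / h) \<longlongrightarrow> 0) (at_left 0)"
      by (rule tendsto_eventually) (auto simp: eventually_at_filter flat_exp_def)
    ultimately have "((\<lambda>h. flat_exp p h / h) \<longlongrightarrow> 0) (at 0)" by (simp add: filterlim_split_at)
    then show ?thesis using 3 by (simp add: DERIV_def flat_exp_def)
  qed
qed

lemma smooth_fun_flat_exp_compose:
  assumes s: "smooth_fun s" shows "smooth_fun (\<lambda>x. flat_exp p (s x))"
proof -
  have "times_differentiable n (\<lambda>x. flat_exp p (s x))" for n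
  proof (induction n arbitrary: p)
    case (Suc n)
    show ?case
      by (rule times_differentiable_SucI[OF DERIV_chain2[OF DERIV_flat_exp smooth_fun_deriv[OF s]]])
        (intro times_differentiable_mult Suc.IH, use smooth_fun_deriv_smooth[OF s] in \<open>auto simp: smooth_fun_iff\<close>)
  qed simp
  then show ?thesis by (simp add: smooth_fun_iff)
qed

section \<open>Line and torus as subsets of the real line with Lebesgue measure\<close>

definition dom_set :: "domain \<Rightarrow> real set" where
  "dom_set \<Omega> = (case \<Omega> of Line \<Rightarrow> UNIV | Torus \<Rightarrow> {0..2*pi})"

lemma dom_set_borel [measurable, simp]: "dom_set \<Omega> \<in> sets borel"
  by (cases \<Omega>) (auto simp: dom_set_def)

lemma dom_measure_eq: "dom_measure \<Omega> = restrict_space lborel (dom_set \<Omega>)"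
proof (cases \<Omega>)
  case Line
  have "restrict_space lborel UNIV = (lborel :: real measure)"
    by (rule measure_eqI) (auto simp: sets_restrict_space emeasure_restrict_space)
  then show ?thesis using Line by (simp add: dom_measure_def dom_set_def)
qed (simp add: dom_measure_def dom_set_def)

lemma integral_dom: "(\<integral>x. g x \<partial>dom_measure \<Omega>) = set_lebesgue_integral lborel (dom_set \<Omega>) g" for g :: "real \<Rightarrow> real"
  by (simp add: dom_measure_eq integral_restrict_space set_lebesgue_integral_def)

lemma integrable_dom: "integrable (dom_measure \<Omega>) g \<longleftrightarrow> set_integrable lborel (dom_set \<Omega>) g" for g :: "real \<Rightarrow> real"
  by (simp add: dom_measure_eq integrable_restrict_space set_integrable_def)

lemma AE_dom: "(AE x in dom_measure \<Omega>. P x) \<longleftrightarrow> (AE x in lborel. x \<in> dom_set \<Omega> \<longrightarrow> P x)"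
  unfolding dom_measure_eq by (subst AE_restrict_space_iff) auto

text \<open>Beyond pi the reflection of |z| to 2 pi - |z| brings the argument back to the range
  where cosine decreases. The bound on |z| is what holds for the distance of any point of [0, 2 pi]
  from the midpoint of a subinterval of length 2 l, even one touching the ends.\<close>

lemma cos_gt_iff_near:
  assumes "0 \<le> l" "l \<le> pi" "\<bar>z\<bar> \<le> 2 * pi - l"
  shows "cos l < cos z \<longleftrightarrow> \<bar>z\<bar> < l"
proof (cases "\<bar>z\<bar> \<le> pi")
  case True
  then show ?thesis using cos_mono_less_eq[of l "\<bar>z\<bar>"] assms by simp
next
  case False
  have "cos z = cos (2 * pi - \<bar>z\<bar>)" by (simp add: cos_diff)
  then show ?thesis using cos_mono_less_eq[of l "2 * pi - \<bar>z\<bar>"] assms False by auto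
qed

text \<open>The bump functions are \<open>exp (- 1 / (n * s x))\<close> where \<open>s\<close> is a smooth function, periodic in the
  case of the torus, that is positive exactly on the given interval.\<close>

lemma test_fun_approx_indicator:
  assumes "p < q" "{p..q} \<subseteq> dom_set \<Omega>"
  obtains \<beta> :: "nat \<Rightarrow> real \<Rightarrow> real" where "\<And>n. test_fun \<Omega> (\<beta> n)"
    "\<And>n x. x \<in> dom_set \<Omega> \<Longrightarrow> 0 \<le> \<beta> n x \<and> \<beta> n x \<le> indicator {p<..<q} x"
    "\<And>x. x \<in> dom_set \<Omega> \<Longrightarrow> (\<lambda>n. \<beta> n x) \<longlonglongrightarrow> indicator {p<..<q} x"
proof -
  \<comment> \<open>On the torus the cosine is centred at the midpoint and lowered by its value at
    the end points, which keeps periodicity. On the line a quadratic suffices.\<close>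
  define s where "s x = (case \<Omega> of Line \<Rightarrow> (x - p) * (q - x) | Torus \<Rightarrow> cos (x - (p + q) / 2) - cos ((q - p) / 2))" for x
  have pos: "s x > 0 \<longleftrightarrow> x \<in> {p<..<q}" if "x \<in> dom_set \<Omega>" for x
  proof (cases \<Omega>)
    case Line
    then show ?thesis using assms(1) by (auto simp: s_def zero_less_mult_iff)
  next
    case Torus
    then have "0 \<le> p" "q \<le> 2 * pi" "0 \<le> x" "x \<le> 2 * pi"
      using assms that by (auto simp: dom_set_def)
    then show ?thesis
      using assms(1) Torus cos_gt_iff_near[of "(q - p) / 2" "x - (p + q) / 2"]
      by (auto simp: s_def abs_less_iff abs_le_iff field_simps)
  qed
  have smooth: "smooth_fun s"
  proof (cases \<Omega>)
    case Line
    have eq: "s = (\<lambda>x. (x + (- p)) * (q + (- 1) * x))" using Line by (auto simp: s_def)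
    show ?thesis unfolding eq by (intro smooth_fun_mult smooth_fun_add smooth_fun_const smooth_fun_id)
  next
    case Torus
    have eq: "s = (\<lambda>x. cos (x - (p + q) / 2) + (- cos ((q - p) / 2)))" using Torus by (auto simp: s_def)
    show ?thesis unfolding eq by (intro smooth_fun_add smooth_fun_const smooth_fun_cos)
  qed
  define \<beta> where "\<beta> n x = flat_exp 1 (real (Suc n) * s x)" for n x
  have \<beta>: "\<beta> n x = (if s x > 0 then exp (- 1 / (real (Suc n) * s x)) else 0)" for n x
    by (simp add: \<beta>_def flat_exp_def zero_less_mult_iff del: of_nat_Suc)
  show ?thesis
  proof (rule that[of \<beta>])
    fix n
    have "smooth_fun (\<beta> n)" unfolding \<beta>_def
      by (intro smooth_fun_flat_exp_compose smooth_fun_mult smooth_fun_const smooth)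
    moreover have "bounded {x. \<beta> n x \<noteq> 0}" if "\<Omega> = Line"
    proof (rule bounded_subset)
      show "{x. \<beta> n x \<noteq> 0} \<subseteq> {p<..<q}"
      proof
        fix x assume "x \<in> {x. \<beta> n x \<noteq> 0}"
        then have "s x > 0" by (simp add: \<beta> split: if_splits)
        then show "x \<in> {p<..<q}" using pos[of x] that by (simp add: dom_set_def)
      qed
    qed simp
    moreover have "\<beta> n (x + 2 * pi) = \<beta> n x" if "\<Omega> = Torus" for x
    proof -
      have "x + 2 * pi - (p + q) / 2 = (x - (p + q) / 2) + 2 * pi" by simp
      then have "s (x + 2 * pi) = s x" using that cos_periodic[of "x - (p + q) / 2"]
        unfolding s_def by (simp only: domain.case)
      then show ?thesis by (simp add: \<beta>_def)
    qed
    ultimately show "test_fun \<Omega> (\<beta> n)" by (auto simp: test_fun_def split: domain.split)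
  next
    fix n x assume "x \<in> dom_set \<Omega>"
    then show "0 \<le> \<beta> n x \<and> \<beta> n x \<le> indicator {p<..<q} x"
      using pos[of x] by (cases "s x > 0") (simp_all add: \<beta> del: of_nat_Suc)
  next
    fix x assume x: "x \<in> dom_set \<Omega>"
    show "(\<lambda>n. \<beta> n x) \<longlonglongrightarrow> indicator {p<..<q} x"
    proof (cases "s x > 0")
      case True
      have "(\<lambda>n. (- 1 / s x) * inverse (real (Suc n))) \<longlonglongrightarrow> (- 1 / s x) * 0"
        by (intro tendsto_mult tendsto_const LIMSEQ_inverse_real_of_nat)
      then have "(\<lambda>n. exp ((- 1 / s x) * inverse (real (Suc n)))) \<longlonglongrightarrow> exp 0"
        by (intro tendsto_exp) simp
      moreover have "\<beta> n x = exp ((- 1 / s x) * inverse (real (Suc n)))" for n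
        using True by (simp add: \<beta> divide_inverse mult.commute del: of_nat_Suc)
      ultimately show ?thesis using True pos[OF x] by simp
    next
      case False
      then have "\<beta> n x = 0" for n by (simp add: \<beta>)
      then show ?thesis using False pos[OF x] by simp
    qed
  qed
qed

subsection \<open>Test functions and the du Bois-Reymond lemma\<close>

text \<open>Conversion to \<open>ennreal\<close> truncates negative values to 0, so the densities of
  f and -f are its positive and negative part. The two measures agree and are finite on the
  half-lines, hence coincide, and so do their densities.\<close>

lemma AE_zero_if_halfline_integrals_zero:
  fixes f :: "real \<Rightarrow> real"
  assumes int: "integrable lborel f"
    and zero: "\<And>p. (LINT x:{p<..}|lborel. f x) = 0"
  shows "AE x in lborel. f x = 0"
proof -
  have m [measurable]: "f \<in> borel_measurable borel" using int by auto
  have em: "emeasure (density lborel (\<lambda>x. ennreal (s * f x))) {p<..} = ennreal (LINT x:{p<..}|lborel. max 0 (s * f x))"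
    for s p :: real
  proof -
    have "integrable lborel (\<lambda>x. indicator {p<..} x *\<^sub>R max 0 (s * f x))"
      using int by (intro integrable_mult_indicator integrable_max integrable_zero) auto
    then have "(\<integral>\<^sup>+ x. ennreal (indicator {p<..} x *\<^sub>R max 0 (s * f x)) \<partial>lborel) = ennreal (LINT x:{p<..}|lborel. max 0 (s * f x))"
      unfolding set_lebesgue_integral_def by (intro nn_integral_eq_integral) (auto simp: indicator_def)
    moreover have "emeasure (density lborel (\<lambda>x. ennreal (s * f x))) {p<..} =
        (\<integral>\<^sup>+ x. ennreal (indicator {p<..} x *\<^sub>R max 0 (s * f x)) \<partial>lborel)"
      by (subst emeasure_density) (auto intro!: nn_integral_cong simp: indicator_def max_def ennreal_neg)
    ultimately show ?thesis by simp
  qed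
  have eq: "(LINT x:{p<..}|lborel. max 0 (1 * f x)) = (LINT x:{p<..}|lborel. max 0 (- 1 * f x))" for p
  proof -
    have i: "set_integrable lborel {p<..} (\<lambda>x. max 0 (s * f x))" for s :: real
      unfolding set_integrable_def using int by (intro integrable_mult_indicator integrable_max integrable_zero) auto
    have "(LINT x:{p<..}|lborel. max 0 (1 * f x)) - (LINT x:{p<..}|lborel. max 0 (- 1 * f x)) =
       (LINT x:{p<..}|lborel. max 0 (1 * f x) - max 0 (- 1 * f x))"
      by (rule set_integral_diff(2)[OF i i, symmetric])
    also have "\<dots> = (LINT x:{p<..}|lborel. f x)"
      by (intro set_lebesgue_integral_cong) auto
    finally show ?thesis using zero by simp
  qed
  have "density lborel (\<lambda>x. ennreal (1 * f x)) = density lborel (\<lambda>x. ennreal (- 1 * f x))"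
    by (rule measure_eqI_lessThan) (simp_all only: em eq, simp_all)
  then have "AE x in lborel. ennreal (1 * f x) = ennreal (- 1 * f x)"
    by (intro sigma_finite_measure.density_unique[OF sigma_finite_lborel]) auto
  then show ?thesis
    by eventually_elim (metis ennreal_eq_0_iff ennreal_neg linorder_le_cases mult_1 mult_minus1 neg_le_0_iff_le order_antisym)
qed

lemma test_fun_smooth: "test_fun \<Omega> \<phi> \<Longrightarrow> smooth_fun \<phi>"
  by (simp add: test_fun_def)

lemma test_fun_add: "test_fun \<Omega> \<phi> \<Longrightarrow> test_fun \<Omega> \<psi> \<Longrightarrow> test_fun \<Omega> (\<lambda>x. \<phi> x + a * \<psi> x)"
  unfolding test_fun_def
  by (auto intro!: smooth_fun_add smooth_fun_mult smooth_fun_const split: domain.splits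
      intro: bounded_subset[of "{x. \<phi> x \<noteq> 0} \<union> {x. \<psi> x \<noteq> 0}"])

text \<open>One formulation for both domains: on the torus B exceeds every point of the fundamental
  period, so vanishing beyond B is vacuous there.\<close>

lemma test_fun_bound:
  assumes \<phi>: "test_fun \<Omega> \<phi>"
  obtains B C where "B > 0" "C \<ge> 0" "\<And>x. x \<in> dom_set \<Omega> \<Longrightarrow> \<bar>\<phi> x\<bar> \<le> C * indicator {-B..B} x"
    "\<And>x. x \<in> dom_set \<Omega> \<Longrightarrow> B \<le> \<bar>x\<bar> \<Longrightarrow> \<phi> x = 0"
proof -
  obtain B where B: "B > 0" "\<And>x. x \<in> dom_set \<Omega> \<Longrightarrow> \<bar>x\<bar> \<ge> B \<Longrightarrow> \<phi> x = 0"
  proof (cases \<Omega>)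
    case Line
    then have "bounded {x. \<phi> x \<noteq> 0}" using \<phi> by (simp add: test_fun_def)
    then obtain B where "B > 0" "\<And>x. \<phi> x \<noteq> 0 \<Longrightarrow> \<bar>x\<bar> \<le> B" by (auto simp: bounded_pos)
    then show ?thesis by (intro that[of "B + 1"]) force+
  next
    case Torus
    show ?thesis by (rule that[of "2 * pi + 1"]) (use Torus in \<open>auto simp: dom_set_def add_pos_pos\<close>)
  qed
  have "bounded (\<phi> ` {-B..B})"
    by (intro compact_imp_bounded compact_continuous_image smooth_fun_continuous test_fun_smooth[OF \<phi>]) auto
  then obtain C where C: "C > 0" "\<And>x. x \<in> {-B..B} \<Longrightarrow> \<bar>\<phi> x\<bar> \<le> C" by (auto simp: bounded_pos)
  show ?thesis
  proof (rule that[of B C])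
    fix x assume x: "x \<in> dom_set \<Omega>"
    show "\<bar>\<phi> x\<bar> \<le> C * indicator {-B..B} x"
      using B(2)[OF x] C(2)[of x] by (cases "x \<in> {-B..B}") auto
  qed (use B C in auto)
qed

lemma test_fun_borel [measurable_dest]: "test_fun \<Omega> \<phi> \<Longrightarrow> \<phi> \<in> borel_measurable borel"
  using smooth_fun_continuous[of \<phi> UNIV] by (simp add: test_fun_smooth borel_measurable_continuous_onI)

lemma test_fun_mult_integrable:
  assumes [measurable]: "w \<in> borel_measurable borel"
    and loc: "\<And>p q. set_integrable lborel ({p..q} \<inter> dom_set \<Omega>) w" and \<phi>: "test_fun \<Omega> \<phi>"
  shows "set_integrable lborel (dom_set \<Omega>) (\<lambda>x. w x * \<phi> x)"
proof -
  have [measurable]: "\<phi> \<in> borel_measurable borel" by (rule test_fun_borel[OF \<phi>])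
  obtain B C where BC: "C \<ge> 0" "\<And>x. x \<in> dom_set \<Omega> \<Longrightarrow> \<bar>\<phi> x\<bar> \<le> C * indicator {-B..B} x"
    using test_fun_bound[OF \<phi>] by metis
  have "integrable lborel (\<lambda>x. C * (indicator ({-B..B} \<inter> dom_set \<Omega>) x *\<^sub>R w x))"
    using loc[of "-B" B] unfolding set_integrable_def by (rule integrable_mult_right)
  then show ?thesis unfolding set_integrable_def
  proof (rule Bochner_Integration.integrable_bound)
    show "AE x in lborel. norm (indicat_real (dom_set \<Omega>) x *\<^sub>R (w x * \<phi> x)) \<le>
        norm (C * (indicat_real ({- B..B} \<inter> dom_set \<Omega>) x *\<^sub>R w x))"
    proof (rule AE_I2)
      fix x
      show "norm (indicat_real (dom_set \<Omega>) x *\<^sub>R (w x * \<phi> x)) \<le>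
        norm (C * (indicat_real ({- B..B} \<inter> dom_set \<Omega>) x *\<^sub>R w x))"
      proof (cases "x \<in> dom_set \<Omega>")
        case True
        have "\<bar>w x\<bar> * \<bar>\<phi> x\<bar> \<le> \<bar>w x\<bar> * (C * indicator {-B..B} x)"
          using BC(2)[OF True] by (rule mult_left_mono) simp
        then show ?thesis using True BC(1) by (simp add: abs_mult indicator_inter_arith mult_ac)
      qed simp
    qed
  qed simp
qed

lemma AE_dom_if_AE_intervals:
  assumes "\<And>a b. a < b \<Longrightarrow> {a..b} \<subseteq> dom_set \<Omega> \<Longrightarrow> AE x in lborel. x \<in> {a<..<b} \<longrightarrow> P x"
  shows "AE x in dom_measure \<Omega>. P x"
proof (cases \<Omega>)
  case Line
  have "AE x in lborel. \<forall>n::nat. x \<in> {- real (Suc n)<..<real (Suc n)} \<longrightarrow> P x"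
    unfolding AE_all_countable by (intro allI assms) (use Line in \<open>auto simp: dom_set_def\<close>)
  then show ?thesis unfolding AE_dom
  proof eventually_elim
    case (elim x)
    obtain n :: nat where "\<bar>x\<bar> < real n" using reals_Archimedean2 by blast
    then show ?case using elim[rule_format, of n] by (auto simp: abs_less_iff)
  qed
next
  case Torus
  have "AE x in lborel. x \<in> {0<..<2*pi} \<longrightarrow> P x" by (rule assms) (use Torus in \<open>auto simp: dom_set_def\<close>)
  moreover have "AE x in lborel. x \<noteq> (0::real)" "AE x in lborel. x \<noteq> 2 * pi" by (rule AE_lborel_singleton)+
  ultimately show ?thesis unfolding AE_dom
    by eventually_elim (use Torus in \<open>auto simp: dom_set_def\<close>)
qed

text \<open>The bumps converge boundedly to indicators of intervals, so dominated convergence makes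
  the integral of w over every such interval vanish. This is the fundamental lemma of the calculus
  of variations.\<close>

lemma AE_zero_if_test_integrals_zero:
  assumes m [measurable]: "w \<in> borel_measurable borel"
    and loc: "\<And>p q. set_integrable lborel ({p..q} \<inter> dom_set \<Omega>) w"
    and zero: "\<And>\<phi>. test_fun \<Omega> \<phi> \<Longrightarrow> (\<integral>x. w x * \<phi> x \<partial>dom_measure \<Omega>) = 0"
  shows "AE x in dom_measure \<Omega>. w x = 0"
proof (rule AE_dom_if_AE_intervals)
  fix a b assume ab: "a < b" "{a..b} \<subseteq> dom_set \<Omega>"
  have pq: "(LINT x:{p<..<q}|lborel. w x) = 0" if pq: "p < q" "{p..q} \<subseteq> dom_set \<Omega>" for p q
  proof -
    obtain \<beta> where \<beta>: "\<And>n. test_fun \<Omega> (\<beta> n)"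
      "\<And>n x. x \<in> dom_set \<Omega> \<Longrightarrow> 0 \<le> \<beta> n x \<and> \<beta> n x \<le> indicator {p<..<q} x"
      "\<And>x. x \<in> dom_set \<Omega> \<Longrightarrow> (\<lambda>n. \<beta> n x) \<longlonglongrightarrow> indicator {p<..<q} x"
      using test_fun_approx_indicator[OF pq] by blast
    have [measurable]: "\<beta> n \<in> borel_measurable borel" for n by (rule test_fun_borel[OF \<beta>(1)])
    have sub: "{p<..<q} \<subseteq> dom_set \<Omega>" using pq(2) by (auto simp: subset_iff)
    have "(\<lambda>n. LINT x|lborel. indicator (dom_set \<Omega>) x *\<^sub>R (w x * \<beta> n x)) \<longlonglongrightarrow>
        (LINT x|lborel. indicator {p<..<q} x *\<^sub>R w x)"
    proof (rule integral_dominated_convergence)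
      have "set_integrable lborel ({p..q} \<inter> dom_set \<Omega>) w" by (rule loc)
      then show "integrable lborel (\<lambda>x. \<bar>indicator ({p..q} \<inter> dom_set \<Omega>) x *\<^sub>R w x\<bar>)"
        unfolding set_integrable_def by (rule integrable_abs)
      show "AE x in lborel. (\<lambda>n. indicator (dom_set \<Omega>) x *\<^sub>R (w x * \<beta> n x)) \<longlonglongrightarrow> indicator {p<..<q} x *\<^sub>R w x"
      proof (rule AE_I2)
        fix x show "(\<lambda>n. indicator (dom_set \<Omega>) x *\<^sub>R (w x * \<beta> n x)) \<longlonglongrightarrow> indicator {p<..<q} x *\<^sub>R w x"
        proof (cases "x \<in> dom_set \<Omega>")
          case True
          then show ?thesis using tendsto_mult[OF tendsto_const \<beta>(3)[OF True], of "w x"]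
            by (simp add: mult.commute)
        next
          case False
          then have "x \<notin> {p<..<q}" using sub by blast
          then show ?thesis using False by simp
        qed
      qed
      show "AE x in lborel. norm (indicator (dom_set \<Omega>) x *\<^sub>R (w x * \<beta> n x)) \<le> \<bar>indicator ({p..q} \<inter> dom_set \<Omega>) x *\<^sub>R w x\<bar>" for n
      proof (rule AE_I2)
        fix x show "norm (indicator (dom_set \<Omega>) x *\<^sub>R (w x * \<beta> n x)) \<le> \<bar>indicator ({p..q} \<inter> dom_set \<Omega>) x *\<^sub>R w x\<bar>"
        proof (cases "x \<in> dom_set \<Omega>")
          case True
          have "\<bar>w x\<bar> * \<bar>\<beta> n x\<bar> \<le> \<bar>w x\<bar> * indicator {p..q} x"
          proof (rule mult_left_mono)
            have "indicator {p<..<q} x \<le> (indicator {p..q} x :: real)" by (simp add: indicator_def)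
            then show "\<bar>\<beta> n x\<bar> \<le> indicator {p..q} x" using \<beta>(2)[OF True, of n] by linarith
          qed simp
          then show ?thesis using True by (simp add: abs_mult mult.commute indicator_inter_arith)
        qed simp
      qed
    qed auto
    moreover have "(LINT x|lborel. indicator (dom_set \<Omega>) x *\<^sub>R (w x * \<beta> n x)) = 0" for n
      using zero[OF \<beta>(1)] by (simp add: integral_dom set_lebesgue_integral_def)
    ultimately have "(\<lambda>n. 0) \<longlonglongrightarrow> (LINT x:{p<..<q}|lborel. w x)"
      by (simp only: set_lebesgue_integral_def)
    then show ?thesis by (simp add: LIMSEQ_const_iff)
  qed
  \<comment> \<open>Cutting w off outside a bounded interval makes it integrable and turns half-line
    integrals into interval integrals.\<close>
  have "AE x in lborel. indicator {a<..<b} x * w x = 0"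
  proof (rule AE_zero_if_halfline_integrals_zero)
    have "set_integrable lborel {a<..<b} w"
      by (rule set_integrable_subset[OF loc[of a b]]) (use ab in auto)
    then show "integrable lborel (\<lambda>x. indicator {a<..<b} x * w x)"
      by (simp add: set_integrable_def)
    fix p
    have "(LINT x:{p<..}|lborel. indicator {a<..<b} x * w x) = (LINT x:{max p a<..<b}|lborel. w x)"
      unfolding set_lebesgue_integral_def
      by (intro Bochner_Integration.integral_cong) (auto simp: indicator_def)
    also have "\<dots> = 0"
    proof (cases "max p a < b")
      case True
      then show ?thesis using ab by (intro pq) auto
    next
      case False
      then have "{max p a<..<b} = {}" by auto
      then show ?thesis by (simp add: set_lebesgue_integral_def)
    qed
    finally show "(LINT x:{p<..}|lborel. indicator {a<..<b} x * w x) = 0" .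
  qed
  then show "AE x in lborel. x \<in> {a<..<b} \<longrightarrow> w x = 0"
    by eventually_elim (auto simp: indicator_def)
qed

lemma ex_antiderivative:
  fixes \<theta> :: "real \<Rightarrow> real"
  assumes "continuous_on UNIV \<theta>"
  obtains \<phi> where "\<And>x. (\<phi> has_real_derivative \<theta> x) (at x)"
  using einterval_antiderivative[of "-\<infinity>" "\<infinity>" \<theta>] assms
  by (auto simp: continuous_on_eq_continuous_at has_real_derivative_iff_has_vector_derivative)

lemma FTC_set_integral:
  fixes \<phi> \<theta> :: "real \<Rightarrow> real"
  assumes "\<And>x. (\<phi> has_real_derivative \<theta> x) (at x)" "continuous_on UNIV \<theta>" "a \<le> b"
  shows "(LINT x:{a..b}|lborel. \<theta> x) = \<phi> b - \<phi> a"
proof -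
  have "(\<theta> has_integral (\<phi> b - \<phi> a)) {a..b}"
    using assms by (intro fundamental_theorem_of_calculus)
      (auto intro: has_field_derivative_at_within simp: has_real_derivative_iff_has_vector_derivative[symmetric])
  moreover have "set_integrable lborel {a..b} \<theta>"
    by (intro borel_integrable_atLeastAtMost' continuous_on_subset[OF assms(2)]) auto
  ultimately show ?thesis by (metis set_borel_integral_eq_integral(2) integral_unique)
qed

text \<open>Vanishing mean makes a primitive return to its initial value: to zero beyond the support
  on the line, and after one period on the torus.\<close>

lemma test_fun_antiderivative:
  assumes \<theta>: "test_fun \<Omega> \<theta>" and zero: "(\<integral>x. \<theta> x \<partial>dom_measure \<Omega>) = 0"
  obtains \<phi> where "test_fun \<Omega> \<phi>" "deriv \<phi> = \<theta>"
proof -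
  have c: "continuous_on UNIV \<theta>" by (rule smooth_fun_continuous[OF test_fun_smooth[OF \<theta>]])
  obtain \<phi>0 where \<phi>0: "\<And>x. (\<phi>0 has_real_derivative \<theta> x) (at x)"
    using ex_antiderivative[OF c] by blast
  obtain B where B: "B > 0" "\<And>x. x \<in> dom_set \<Omega> \<Longrightarrow> B \<le> \<bar>x\<bar> \<Longrightarrow> \<theta> x = 0"
    using test_fun_bound[OF \<theta>] by metis
  define \<phi> where "\<phi> x = \<phi>0 x - \<phi>0 (- B)" for x
  have d: "(\<phi> has_real_derivative \<theta> x) (at x)" for x
    unfolding \<phi>_def using \<phi>0 by (auto intro!: derivative_eq_intros)
  have diff: "(LINT x:{a..b}|lborel. \<theta> x) = \<phi> b - \<phi> a" if "a \<le> b" for a b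
    by (rule FTC_set_integral[OF d c that])
  have "smooth_fun \<phi>" by (rule smooth_funI[OF d test_fun_smooth[OF \<theta>]])
  moreover have "bounded {x. \<phi> x \<noteq> 0}" if L: "\<Omega> = Line"
  proof (rule bounded_subset)
    have z: "\<theta> x = 0" if "B \<le> \<bar>x\<bar>" for x using B(2)[of x] that L by (simp add: dom_set_def)
    show "{x. \<phi> x \<noteq> 0} \<subseteq> {-B..B}"
    proof
      fix x assume x: "x \<in> {x. \<phi> x \<noteq> 0}"
      show "x \<in> {-B..B}"
      proof (rule ccontr)
        assume "x \<notin> {-B..B}"
        then consider "x < - B" | "x > B" by fastforce
        then have "\<phi> x = 0"
        proof cases
          case 1
          have "(LINT y:{x..-B}|lborel. \<theta> y) = (LINT y:{x..-B}|lborel. 0)"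
            by (intro set_lebesgue_integral_cong) (use B(1) z in auto)
          then show ?thesis using diff[of x "-B"] 1 by (simp add: \<phi>_def)
        next
          case 2
          have "0 = (LINT y:UNIV|lborel. \<theta> y)" using zero L by (simp add: integral_dom dom_set_def)
          also have "\<dots> = (LINT y:{-B..x}|lborel. \<theta> y)" unfolding set_lebesgue_integral_def
          proof (intro Bochner_Integration.integral_cong refl)
            fix y show "indicator UNIV y *\<^sub>R \<theta> y = indicator {-B..x} y *\<^sub>R \<theta> y"
              using z[of y] 2 by (cases "y \<in> {-B..x}") auto
          qed
          also have "\<dots> = \<phi> x" using diff[of "-B" x] 2 B(1) by (simp add: \<phi>_def)
          finally show ?thesis by simp
        qed
        then show False using x by simp
      qed
    qed
  qed simp
  moreover have "\<phi> (x + 2 * pi) = \<phi> x" if T: "\<Omega> = Torus" for x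
  proof -
    have per: "\<theta> (x + 2 * pi) = \<theta> x" for x using \<theta> T by (simp add: test_fun_def)
    have "((\<lambda>x. \<phi> (x + 2 * pi) - \<phi> x) has_real_derivative 0) (at x)" for x
      using DERIV_diff[OF DERIV_shift[THEN iffD1, OF d[of "x + 2 * pi"]] d[of x]] per by simp
    then have "\<phi> (x + 2 * pi) - \<phi> x = \<phi> (0 + 2 * pi) - \<phi> 0"
      by (rule DERIV_isconst_all[OF allI])
    also have "\<dots> = 0" using diff[of 0 "2 * pi"] zero T by (simp add: integral_dom dom_set_def)
    finally show ?thesis by simp
  qed
  ultimately have "test_fun \<Omega> \<phi>" by (auto simp: test_fun_def split: domain.split)
  moreover have "deriv \<phi> = \<theta>" using d DERIV_imp_deriv by blast
  ultimately show ?thesis by (rule that)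
qed

text \<open>Subtracting a multiple of a fixed \<psi> with nonzero integral gives any test function
  mean zero, hence makes it a derivative, which w annihilates. The constant is the mean of w
  weighted by \<psi>.\<close>

lemma AE_const_if_test_deriv_integrals_zero:
  assumes m [measurable]: "w \<in> borel_measurable borel"
    and loc: "\<And>p q. set_integrable lborel ({p..q} \<inter> dom_set \<Omega>) w"
    and zero: "\<And>\<phi>. test_fun \<Omega> \<phi> \<Longrightarrow> (\<integral>x. w x * deriv \<phi> x \<partial>dom_measure \<Omega>) = 0"
  shows "\<exists>c. AE x in dom_measure \<Omega>. w x = c"
proof -
  have loc1: "set_integrable lborel ({p..q} \<inter> dom_set \<Omega>) (\<lambda>_. c)" for p q c :: real
    by (rule set_integrable_subset[OF borel_integrable_atLeastAtMost'[of p q]]) auto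
  have int1: "integrable (dom_measure \<Omega>) \<phi>" if "test_fun \<Omega> \<phi>" for \<phi>
    using test_fun_mult_integrable[OF _ loc1[of _ _ 1] that] by (simp add: integrable_dom)
  have intw: "integrable (dom_measure \<Omega>) (\<lambda>x. w x * \<phi> x)" if "test_fun \<Omega> \<phi>" for \<phi>
    using test_fun_mult_integrable[OF m loc that] by (simp add: integrable_dom)
  \<comment> \<open>No bump is integrated explicitly: if all test functions had integral zero, the
    fundamental lemma for w = 1 would give 1 = 0 almost everywhere.\<close>
  obtain \<psi> where \<psi>: "test_fun \<Omega> \<psi>" "(\<integral>x. \<psi> x \<partial>dom_measure \<Omega>) \<noteq> 0"
  proof -
    have "\<not> (AE x in dom_measure \<Omega>. (1::real) = 0)"
    proof
      assume "AE x in dom_measure \<Omega>. (1::real) = 0"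
      then have "AE x in lborel. x \<notin> dom_set \<Omega>" by (simp add: AE_dom)
      moreover have "{0<..<1::real} \<noteq> {}" by auto
      ultimately obtain x where "x \<in> {0<..<1}" "x \<notin> dom_set \<Omega>"
        using AE_lborel_open_witness[of "{0<..<1}" "\<lambda>x. x \<notin> dom_set \<Omega>"] open_greaterThanLessThan by metis
      then show False using pi_gt3 by (cases \<Omega>) (auto simp: dom_set_def)
    qed
    then show ?thesis using AE_zero_if_test_integrals_zero[of "\<lambda>_. 1", OF _ loc1] that by auto
  qed
  define c where "c = (\<integral>x. w x * \<psi> x \<partial>dom_measure \<Omega>) / (\<integral>x. \<psi> x \<partial>dom_measure \<Omega>)"
  have "AE x in dom_measure \<Omega>. w x - c = 0"
  proof (rule AE_zero_if_test_integrals_zero)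
    show "set_integrable lborel ({p..q} \<inter> dom_set \<Omega>) (\<lambda>x. w x - c)" for p q
      by (rule set_integral_diff(1)[OF loc loc1])
    fix \<phi> assume \<phi>: "test_fun \<Omega> \<phi>"
    define r where "r = (\<integral>x. \<phi> x \<partial>dom_measure \<Omega>) / (\<integral>x. \<psi> x \<partial>dom_measure \<Omega>)"
    have t: "test_fun \<Omega> (\<lambda>x. \<phi> x + (- r) * \<psi> x)" by (rule test_fun_add[OF \<phi> \<psi>(1)])
    have "(\<integral>x. \<phi> x + (- r) * \<psi> x \<partial>dom_measure \<Omega>) = 0"
      using int1[OF \<phi>] int1[OF \<psi>(1)] \<psi>(2) by (simp add: r_def)
    then obtain \<Phi> where "test_fun \<Omega> \<Phi>" "deriv \<Phi> = (\<lambda>x. \<phi> x + (- r) * \<psi> x)"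
      using test_fun_antiderivative[OF t] by blast
    then have "(\<integral>x. w x * (\<phi> x + (- r) * \<psi> x) \<partial>dom_measure \<Omega>) = 0" using zero[of \<Phi>] by simp
    then have "(\<integral>x. w x * \<phi> x - r * (w x * \<psi> x) \<partial>dom_measure \<Omega>) = 0"
      by (simp add: algebra_simps)
    then have "(\<integral>x. w x * \<phi> x \<partial>dom_measure \<Omega>) = r * (\<integral>x. w x * \<psi> x \<partial>dom_measure \<Omega>)"
      using intw[OF \<phi>] intw[OF \<psi>(1)] by simp
    also have "\<dots> = c * (\<integral>x. \<phi> x \<partial>dom_measure \<Omega>)" by (simp add: r_def c_def)
    finally show "(\<integral>x. (w x - c) * \<phi> x \<partial>dom_measure \<Omega>) = 0"
      using intw[OF \<phi>] int1[OF \<phi>] by (simp add: left_diff_distrib)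
  qed simp
  then show ?thesis by auto
qed

subsection \<open>Indefinite Lebesgue integrals\<close>

text \<open>Local absolute continuity in integrated form. It leaves H free up to a constant and
  speaks about all of R, also when h is periodic, because the interface equation evaluates its
  functions off the period.\<close>

definition indefinite_integral :: "(real \<Rightarrow> real) \<Rightarrow> (real \<Rightarrow> real) \<Rightarrow> bool" where
  "indefinite_integral h H \<longleftrightarrow> (\<forall>x y. x \<le> y \<longrightarrow> set_integrable lborel {x..y} h \<and> H y - H x = (LINT z:{x..y}|lborel. h z))"

lemma indefinite_integralD:
  assumes "indefinite_integral h H" "x \<le> y"
  shows "set_integrable lborel {x..y} h" "H y - H x = (LINT z:{x..y}|lborel. h z)"
  using assms by (auto simp: indefinite_integral_def)

lemma ex_indefinite_integral:
  assumes "\<And>x y. set_integrable lborel {x..y} h"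
  shows "\<exists>H. indefinite_integral h H"
proof -
  have "(LBINT z=0..y. h z) - (LBINT z=0..x. h z) = (LINT z:{x..y}|lborel. h z)" if "x \<le> y" for x y :: real
  proof -
    have "set_integrable lborel {a<..<b} h" for a b
      by (rule set_integrable_subset[OF assms[of a b]]) auto
    then have "interval_lebesgue_integrable lborel (ereal a) (ereal b) h" for a b
      by (simp add: interval_lebesgue_integrable_def)
    then have "(LBINT z=0..x. h z) + (LBINT z=x..y. h z) = (LBINT z=0..y. h z)"
      unfolding zero_ereal_def by (intro interval_integral_sum) (auto simp: min_def max_def)
    then show ?thesis using interval_integral_Icc[of x y h] that by simp
  qed
  then have "indefinite_integral h (\<lambda>x. LBINT z=0..x. h z)"
    unfolding indefinite_integral_def using assms by simp
  then show ?thesis by blast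
qed

lemma indefinite_integral_continuous:
  assumes "indefinite_integral h H"
  shows "continuous_on S H"
proof -
  have "isCont H x" for x
  proof -
    have "set_integrable lborel {x - 1..x + 1} h" by (rule indefinite_integralD[OF assms]) simp
    then have "continuous_on {x - 1..x + 1} (\<lambda>y. integral {x - 1..y} h)"
      by (intro indefinite_integral_continuous_1 set_borel_integral_eq_integral(1))
    then have "continuous_on {x - 1..x + 1} (\<lambda>y. H (x - 1) + integral {x - 1..y} h)"
      by (intro continuous_intros)
    moreover have "H (x - 1) + integral {x - 1..y} h = H y" if "y \<in> {x - 1..x + 1}" for y
      using indefinite_integralD[OF assms, of "x - 1" y] that
      by (simp add: set_borel_integral_eq_integral(2))
    ultimately have "continuous_on {x - 1..x + 1} H" using continuous_on_cong by (metis (no_types, lifting))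
    then show ?thesis by (rule continuous_on_interior) auto
  qed
  then show ?thesis by (simp add: continuous_at_imp_continuous_on)
qed

text \<open>H has no pointwise derivative to which a product rule could be applied, so both sides
  are computed as iterated integrals over a triangle and compared by Fubini.\<close>

lemma indefinite_integral_by_parts:
  assumes H: "indefinite_integral h H" and m [measurable]: "h \<in> borel_measurable borel"
    and \<phi>: "\<And>x. (\<phi> has_real_derivative \<phi>' x) (at x)" "continuous_on UNIV \<phi>'" and ab: "a \<le> b"
  shows "(LINT x:{a..b}|lborel. H x * \<phi>' x) = H b * \<phi> b - H a * \<phi> a - (LINT x:{a..b}|lborel. h x * \<phi> x)"
proof -
  have [measurable]: "\<phi>' \<in> borel_measurable borel" using \<phi>(2) by (rule borel_measurable_continuous_onI)
  have c\<phi>: "continuous_on UNIV \<phi>"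
    by (rule continuous_at_imp_continuous_on) (use \<phi>(1) DERIV_isCont in blast)
  have [measurable]: "\<phi> \<in> borel_measurable borel" using c\<phi> by (rule borel_measurable_continuous_onI)
  \<comment> \<open>This is h(y) \<phi>'(x) on the triangle a \<le> y \<le> x \<le> b. Integrating
    in y first yields H x - H a, in x first \<phi> b - \<phi> y.\<close>
  define f where "f y x = indicator {a..b} y * h y * (indicator {y..b} x * \<phi>' x)" for x y
  have ih: "integrable lborel (\<lambda>y. indicator {a..b} y * h y)"
    using indefinite_integralD(1)[OF H ab] by (simp add: set_integrable_def)
  have i\<phi>': "integrable lborel (\<lambda>x. indicator {y..b} x * \<phi>' x)" for y
    using borel_integrable_atLeastAtMost'[OF continuous_on_subset[OF \<phi>(2)], of y b] by (simp add: set_integrable_def)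
  have fin: "integrable (lborel \<Otimes>\<^sub>M lborel) (case_prod f)"
  proof (rule lborel_pair.Fubini_integrable)
    have "case_prod f = (\<lambda>z. indicator {a..b} (fst z) * h (fst z) * (indicator {x. fst x \<le> snd x} z * indicator {..b} (snd z) * \<phi>' (snd z)))"
      by (auto simp: f_def indicator_def fun_eq_iff)
    then show "case_prod f \<in> borel_measurable (lborel \<Otimes>\<^sub>M lborel)" by simp
    show "AE y in lborel. integrable lborel (\<lambda>x. case_prod f (y, x))"
      using i\<phi>' by (auto simp: f_def)
    show "integrable lborel (\<lambda>y. LINT x|lborel. norm (case_prod f (y, x)))"
    proof (rule Bochner_Integration.integrable_bound)
      show "integrable lborel (\<lambda>y. (indicator {a..b} y * h y) * (LINT x|lborel. \<bar>indicator {a..b} x * \<phi>' x\<bar>))"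
        using ih by (rule integrable_mult_left)
      show "(\<lambda>y. LINT x|lborel. norm (case_prod f (y, x))) \<in> borel_measurable lborel"
        using \<open>case_prod f \<in> borel_measurable (lborel \<Otimes>\<^sub>M lborel)\<close> by measurable
      show "AE y in lborel. norm (LINT x|lborel. norm (case_prod f (y, x))) \<le>
          norm ((indicator {a..b} y * h y) * (LINT x|lborel. \<bar>indicator {a..b} x * \<phi>' x\<bar>))"
      proof (rule AE_I2)
        fix y
        show "norm (LINT x|lborel. norm (case_prod f (y, x))) \<le>
          norm ((indicator {a..b} y * h y) * (LINT x|lborel. \<bar>indicator {a..b} x * \<phi>' x\<bar>))"
        proof (cases "y \<in> {a..b}")
          case True
          have "(LINT x|lborel. norm (case_prod f (y, x))) = \<bar>h y\<bar> * (LINT x|lborel. \<bar>indicator {y..b} x * \<phi>' x\<bar>)"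
            using True by (simp add: f_def abs_mult)
          moreover have "(LINT x|lborel. \<bar>indicator {y..b} x * \<phi>' x\<bar>) \<le> (LINT x|lborel. \<bar>indicator {a..b} x * \<phi>' x\<bar>)"
            using True i\<phi>' by (intro integral_mono integrable_abs) (auto simp: indicator_def)
          ultimately show ?thesis using True by (simp add: abs_mult mult_left_mono)
        qed (simp add: f_def)
      qed
    qed
  qed
  have "(LINT x|lborel. LINT y|lborel. f y x) = (LINT y|lborel. LINT x|lborel. f y x)"
    by (rule lborel_pair.Fubini_integral[OF fin])
  moreover have "(LINT y|lborel. f y x) = indicator {a..b} x * ((H x - H a) * \<phi>' x)" for x
  proof (cases "x \<in> {a..b}")
    case True
    have "(LINT y|lborel. f y x) = (LINT y|lborel. (indicator {a..x} y *\<^sub>R h y) * \<phi>' x)"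
      by (intro Bochner_Integration.integral_cong) (use True in \<open>auto simp: f_def indicator_def\<close>)
    also have "\<dots> = (LINT z:{a..x}|lborel. h z) * \<phi>' x" unfolding set_lebesgue_integral_def
      by (rule integral_mult_left_zero)
    finally show ?thesis using True indefinite_integralD(2)[OF H, of a x] by simp
  next
    case False
    then have "f y x = 0" for y by (auto simp: f_def indicator_def)
    then show ?thesis using False by simp
  qed
  moreover have "(LINT x|lborel. f y x) = indicator {a..b} y * (h y * (\<phi> b - \<phi> y))" for y
  proof (cases "y \<in> {a..b}")
    case True
    have "(LINT x|lborel. f y x) = h y * (LINT x:{y..b}|lborel. \<phi>' x)"
      using True by (simp add: f_def set_lebesgue_integral_def)
    then show ?thesis using True FTC_set_integral[OF \<phi>, of y b] by simp
  qed (simp add: f_def)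
  ultimately have main: "(LINT x:{a..b}|lborel. (H x - H a) * \<phi>' x) = (LINT y:{a..b}|lborel. h y * (\<phi> b - \<phi> y))"
    by (simp add: set_lebesgue_integral_def)
  have iH: "set_integrable lborel {a..b} (\<lambda>x. H x * \<phi>' x)"
    by (intro borel_integrable_atLeastAtMost' continuous_intros indefinite_integral_continuous[OF H] continuous_on_subset[OF \<phi>(2)]) auto
  have i1: "set_integrable lborel {a..b} (\<lambda>x. H a * \<phi>' x)"
    by (intro borel_integrable_atLeastAtMost' continuous_intros continuous_on_subset[OF \<phi>(2)]) auto
  have i2: "set_integrable lborel {a..b} (\<lambda>y. h y * \<phi> b)"
    using indefinite_integralD(1)[OF H ab] by simp
  have i3: "set_integrable lborel {a..b} (\<lambda>y. h y * \<phi> y)"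
  proof -
    have "bounded (\<phi> ` {a..b})"
      by (intro compact_imp_bounded compact_continuous_image continuous_on_subset[OF c\<phi>]) auto
    then obtain C where "\<forall>x\<in>{a..b}. \<bar>\<phi> x\<bar> \<le> C" by (auto simp: bounded_iff)
    then have C: "\<bar>\<phi> x\<bar> \<le> C" if "x \<in> {a..b}" for x using that by blast
    have "set_integrable lborel {a..b} (\<lambda>y. h y * C)"
      using indefinite_integralD(1)[OF H ab] by simp
    then show ?thesis
    proof (rule set_integrable_bound)
      show "AE x in lborel. x \<in> {a..b} \<longrightarrow> norm (h x * \<phi> x) \<le> norm (h x * C)"
      proof (intro AE_I2 impI)
        fix x assume "x \<in> {a..b}"
        then have "\<bar>h x\<bar> * \<bar>\<phi> x\<bar> \<le> \<bar>h x\<bar> * \<bar>C\<bar>"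
          using C[of x] by (intro mult_left_mono) auto
        then show "norm (h x * \<phi> x) \<le> norm (h x * C)" by (simp add: abs_mult)
      qed
    qed (simp add: set_borel_measurable_def)
  qed
  have "(LINT x:{a..b}|lborel. (H x - H a) * \<phi>' x) = (LINT x:{a..b}|lborel. H x * \<phi>' x) - H a * (\<phi> b - \<phi> a)"
    using set_integral_diff(2)[OF iH i1] FTC_set_integral[OF \<phi> ab] by (simp add: left_diff_distrib)
  moreover have "(LINT y:{a..b}|lborel. h y * (\<phi> b - \<phi> y)) = (H b - H a) * \<phi> b - (LINT y:{a..b}|lborel. h y * \<phi> y)"
    using set_integral_diff(2)[OF i2 i3] indefinite_integralD(2)[OF H ab] by (simp add: right_diff_distrib)
  ultimately have "(LINT x:{a..b}|lborel. H x * \<phi>' x) - H a * (\<phi> b - \<phi> a) =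
      (H b - H a) * \<phi> b - (LINT y:{a..b}|lborel. h y * \<phi> y)"
    using main by (simp only:)
  then show ?thesis unfolding right_diff_distrib left_diff_distrib by linarith
qed

subsection \<open>Weak derivatives on the line and the torus\<close>

text \<open>\<open>P\<close> may be nonmeasurable, so the substitution is made in a Borel null set
  that covers its failures. With c = -1 an identity a.e. in y becomes one a.e. in \<alpha> at y = x
  - \<alpha>.\<close>

lemma AE_lborel_affine:
  fixes P :: "real \<Rightarrow> bool"
  assumes c: "c \<noteq> 0" and "AE x in lborel. P x"
  shows "AE x in lborel. P (t + c * x)"
proof -
  obtain N where N: "{x \<in> space lborel. \<not> P x} \<subseteq> N" "N \<in> null_sets lborel"
    using assms(2) by (auto simp: eventually_ae_filter)
  have [measurable]: "N \<in> sets borel" using N(2) by (auto simp: null_sets_def)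
  have "AE x in lborel. x \<notin> N" by (rule AE_not_in[OF N(2)])
  then have "AE x in lborel. t + c * x \<notin> N"
    by (intro AE_borel_affine[OF c, of "\<lambda>x. x \<notin> N"]) auto
  then show ?thesis by eventually_elim (use N(1) in auto)
qed

lemma periodic_shift_int:
  fixes p :: real
  assumes "\<And>x. f (x + p) = f x"
  shows "f (x + of_int k * p) = f x"
proof -
  interpret periodic_fun_simple f p by standard (rule assms)
  show ?thesis by (rule plus_of_int)
qed

lemma periodic_shift_into_torus:
  obtains k :: int where "x + of_int k * (2 * pi) \<in> {0..2 * pi}"
proof (rule that[of "- \<lfloor>x / (2 * pi)\<rfloor>"])
  have "of_int \<lfloor>x / (2 * pi)\<rfloor> * (2 * pi) \<le> x"
    using of_int_floor_le[of "x / (2 * pi)"] by (subst pos_le_divide_eq[symmetric]) auto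
  moreover have "x \<le> (of_int \<lfloor>x / (2 * pi)\<rfloor> + 1) * (2 * pi)"
    using real_of_int_floor_add_one_ge[of "x / (2 * pi)"] by (subst pos_divide_le_eq[symmetric]) auto
  ultimately show "x + of_int (- \<lfloor>x / (2 * pi)\<rfloor>) * (2 * pi) \<in> {0..2 * pi}"
    by (simp add: algebra_simps)
qed

text \<open>Countably many translates of the period cover the line. The principal value runs over R
  also for the torus, so facts about one period have to be spread.\<close>

lemma AE_lborel_if_AE_dom:
  assumes "AE x in dom_measure \<Omega>. P x" and per: "\<Omega> = Torus \<Longrightarrow> \<forall>x. P (x + 2 * pi) = P x"
  shows "AE x in lborel. P x"
proof (cases \<Omega>)
  case Line
  then show ?thesis using assms(1) by (simp add: AE_dom dom_set_def)
next
  case Torus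
  have P: "P (x + of_int k * (2 * pi)) = P x" for x k
    by (rule periodic_shift_int) (use per[OF Torus] in blast)
  have "AE x in lborel. \<forall>k::int. of_int k * (2 * pi) + 1 * x \<in> {0..2*pi} \<longrightarrow> P (of_int k * (2 * pi) + 1 * x)"
    unfolding AE_all_countable
    using assms(1) Torus by (intro allI AE_lborel_affine) (auto simp: AE_dom dom_set_def)
  then show ?thesis
  proof eventually_elim
    case (elim x)
    obtain k :: int where "x + of_int k * (2 * pi) \<in> {0..2 * pi}" by (rule periodic_shift_into_torus)
    then show ?case using elim[rule_format, of k] P[of x k] by (simp add: add.commute)
  qed
qed

definition square_integrable_dom :: "domain \<Rightarrow> (real \<Rightarrow> real) \<Rightarrow> bool" where
  "square_integrable_dom \<Omega> g \<longleftrightarrow>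
     admissible \<Omega> g \<and> g \<in> borel_measurable borel \<and> integrable (dom_measure \<Omega>) (\<lambda>x. (g x)\<^sup>2)"

lemma square_integrable_dom_periodic:
  "square_integrable_dom \<Omega> g \<Longrightarrow> \<Omega> = Torus \<Longrightarrow> g (x + 2 * pi) = g x"
  by (auto simp: square_integrable_dom_def admissible_def)

lemma square_integrable_dom_locally_integrable:
  assumes g: "square_integrable_dom \<Omega> g"
  shows "set_integrable lborel ({p..q} \<inter> dom_set \<Omega>) g"
proof -
  have [measurable]: "g \<in> borel_measurable borel" using g by (simp add: square_integrable_dom_def)
  have "set_integrable lborel (dom_set \<Omega>) (\<lambda>x. (g x)\<^sup>2)"
    using g by (simp add: square_integrable_dom_def integrable_dom)
  then have "set_integrable lborel ({p..q} \<inter> dom_set \<Omega>) (\<lambda>x. (g x)\<^sup>2)"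
    by (rule set_integrable_subset) auto
  moreover have "set_integrable lborel ({p..q} \<inter> dom_set \<Omega>) (\<lambda>_. 1 :: real)"
    by (rule set_integrable_subset[OF borel_integrable_atLeastAtMost'[of p q]]) auto
  ultimately have "set_integrable lborel ({p..q} \<inter> dom_set \<Omega>) (\<lambda>x. 1 + (g x)\<^sup>2)"
    by (intro set_integral_add)
  then show ?thesis
  proof (rule set_integrable_bound)
    have "\<bar>g x\<bar> \<le> 1 + (g x)\<^sup>2" for x
      using sum_squares_bound[of 1 "\<bar>g x\<bar>"] by (auto simp: abs_le_iff)
    then show "AE x in lborel. x \<in> {p..q} \<inter> dom_set \<Omega> \<longrightarrow> norm (g x) \<le> norm (1 + (g x)\<^sup>2)"
      by (auto intro: order_trans)
  qed (simp add: set_borel_measurable_def)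
qed

text \<open>On the torus each translate of the period inherits integrability from [0, 2 pi], and
  finitely many translates cover a given interval.\<close>

lemma square_integrable_dom_integrable_Icc:
  assumes g: "square_integrable_dom \<Omega> g"
  shows "set_integrable lborel {x..y} g"
proof (cases \<Omega>)
  case Line
  then show ?thesis using square_integrable_dom_locally_integrable[OF g, of x y] by (simp add: dom_set_def)
next
  case Torus
  have g0: "set_integrable lborel {0..2 * pi} g"
    using square_integrable_dom_locally_integrable[OF g, of 0 "2 * pi"] Torus by (simp add: dom_set_def)
  have gk: "set_integrable lborel {of_int k * (2 * pi)..of_int (k + 1) * (2 * pi)} g" for k :: int
  proof -
    have per: "g (x + of_int k * (2 * pi)) = g x" for x k
      by (rule periodic_shift_int) (rule square_integrable_dom_periodic[OF g Torus])
    have "integrable lborel (\<lambda>x. indicator {0..2 * pi} (of_int (- k) * (2 * pi) + 1 * x) *\<^sub>R g (of_int (- k) * (2 * pi) + 1 * x))"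
      using g0 unfolding set_integrable_def by (rule lborel_integrable_real_affine) simp
    moreover have "indicator {0..2 * pi} (of_int (- k) * (2 * pi) + 1 * x) *\<^sub>R g (of_int (- k) * (2 * pi) + 1 * x)
       = indicator {of_int k * (2 * pi)..of_int (k + 1) * (2 * pi)} x *\<^sub>R g x" for x
      using per[of x "- k"] by (auto simp: indicator_def algebra_simps)
    ultimately show ?thesis unfolding set_integrable_def by simp
  qed
  have "set_integrable lborel {- real n * (2 * pi)..real n * (2 * pi)} g" for n
  proof (induction n)
    case 0
    show ?case by (rule set_integrable_subset[OF g0]) auto
  next
    case (Suc n)
    have "set_integrable lborel ({- real n * (2 * pi)..real n * (2 * pi)}
        \<union> {real n * (2 * pi)..(real n + 1) * (2 * pi)} \<union> {(- real n - 1) * (2 * pi)..(- real n) * (2 * pi)}) g"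
      using gk[of "int n"] gk[of "- int n - 1"] Suc by (intro set_integrable_Un) auto
    then show ?case
      by (rule set_integrable_subset) (auto simp: algebra_simps)
  qed
  note n = this
  obtain n :: nat where "max \<bar>x\<bar> \<bar>y\<bar> / (2 * pi) < real n" using reals_Archimedean2 by blast
  then have "max \<bar>x\<bar> \<bar>y\<bar> < real n * (2 * pi)" by (subst pos_divide_less_eq[symmetric]) auto
  then have "{x..y} \<subseteq> {- real n * (2 * pi)..real n * (2 * pi)}" by (auto simp: abs_if split: if_splits)
  then show ?thesis using set_integrable_subset[OF n] by auto
qed

lemma test_fun_deriv:
  assumes \<phi>: "test_fun \<Omega> \<phi>" shows "test_fun \<Omega> (deriv \<phi>)"
proof -
  have s: "smooth_fun \<phi>" by (rule test_fun_smooth[OF \<phi>])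
  have "bounded {x. deriv \<phi> x \<noteq> 0}" if L: "\<Omega> = Line"
  proof -
    obtain B where B: "\<And>x. B \<le> \<bar>x\<bar> \<Longrightarrow> \<phi> x = 0"
      using test_fun_bound[OF \<phi>] L by (metis dom_set_def domain.case(1) UNIV_I)
    have "deriv \<phi> x = 0" if "x \<notin> {-B..B}" for x
    proof -
      have "((\<lambda>_. 0) has_real_derivative deriv \<phi> x) (at x)"
        by (rule has_field_derivative_transform_within_open[of \<phi> "deriv \<phi> x" x "- {-B..B}", OF smooth_fun_deriv[OF s]])
          (use that B in \<open>auto simp: abs_if\<close>)
      then show ?thesis using DERIV_unique[OF _ DERIV_const] by blast
    qed
    then have "{x. deriv \<phi> x \<noteq> 0} \<subseteq> {-B..B}" by blast
    then show ?thesis using bounded_subset bounded_closed_interval by blast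
  qed
  moreover have "deriv \<phi> (x + 2 * pi) = deriv \<phi> x" if T: "\<Omega> = Torus" for x
  proof -
    have "(\<lambda>x. \<phi> (x + 2 * pi)) = \<phi>" using \<phi> T by (auto simp: test_fun_def)
    then have "(\<phi> has_real_derivative deriv \<phi> (x + 2 * pi)) (at x)"
      using DERIV_shift[THEN iffD1, OF smooth_fun_deriv[OF s, of "x + 2 * pi"]] by simp
    then show ?thesis using DERIV_unique smooth_fun_deriv[OF s] by blast
  qed
  ultimately show ?thesis
    using smooth_fun_deriv_smooth[OF s] by (auto simp: test_fun_def split: domain.split)
qed

text \<open>The single-step relation between consecutive weak derivatives; the representation and
  sup estimates are proved for it and then used at each order.\<close>

definition weak_derivative :: "domain \<Rightarrow> (real \<Rightarrow> real) \<Rightarrow> (real \<Rightarrow> real) \<Rightarrow> bool" where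
  "weak_derivative \<Omega> u h \<longleftrightarrow> square_integrable_dom \<Omega> u \<and> square_integrable_dom \<Omega> h \<and>
     (\<forall>\<phi>. test_fun \<Omega> \<phi> \<longrightarrow> (\<integral>x. u x * deriv \<phi> x \<partial>dom_measure \<Omega>) = - (\<integral>x. h x * \<phi> x \<partial>dom_measure \<Omega>))"

text \<open>On the torus the constant 1 is a test function; testing with it shows that h has mean
  zero over a period.\<close>

lemma weak_derivative_indefinite_integral_periodic:
  assumes uh: "weak_derivative Torus u h" and H: "indefinite_integral h H"
  shows "H (x + 2 * pi) = H x"
proof -
  have h: "square_integrable_dom Torus h" using uh by (simp add: weak_derivative_def)
  have "test_fun Torus (\<lambda>_. 1)" by (simp add: test_fun_def smooth_fun_const)
  then have "(\<integral>x. u x * deriv (\<lambda>_. 1) x \<partial>dom_measure Torus) = - (\<integral>x. h x * 1 \<partial>dom_measure Torus)"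
    using uh unfolding weak_derivative_def by blast
  then have "(\<integral>x. h x \<partial>dom_measure Torus) = 0" by simp
  then have "(LINT x:{0..2 * pi}|lborel. h x) = 0" by (simp add: integral_dom dom_set_def)
  then have z: "H (2 * pi) = H 0" using indefinite_integralD(2)[OF H, of 0 "2 * pi"] by simp
  have shift: "H (y + 2 * pi) - H (x + 2 * pi) = H y - H x" if "x \<le> y" for x y
  proof -
    have "(LINT z:{x + 2 * pi..y + 2 * pi}|lborel. h z) =
        (\<integral>z. indicator {x + 2 * pi..y + 2 * pi} (2 * pi + 1 * z) *\<^sub>R h (2 * pi + 1 * z) \<partial>lborel)"
      unfolding set_lebesgue_integral_def
      using lborel_integral_real_affine[of 1 "\<lambda>z. indicator {x + 2 * pi..y + 2 * pi} z *\<^sub>R h z" "2 * pi"] by simp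
    also have "\<dots> = (LINT z:{x..y}|lborel. h z)" unfolding set_lebesgue_integral_def
      using square_integrable_dom_periodic[OF h]
      by (intro Bochner_Integration.integral_cong) (auto simp: indicator_def add.commute)
    finally show ?thesis using indefinite_integralD(2)[OF H] that by simp
  qed
  show ?thesis using shift[of 0 x] shift[of x 0] z by (cases "0 \<le> x") auto
qed

text \<open>Boundary terms vanish outside the support on the line and cancel by periodicity on the
  torus. Thus H satisfies the same identity as u, which makes u - H a candidate for the du
  Bois-Reymond lemma.\<close>

lemma weak_derivative_integration_by_parts:
  assumes uh: "weak_derivative \<Omega> u h" and H: "indefinite_integral h H" and \<phi>: "test_fun \<Omega> \<phi>"
  shows "(\<integral>x. H x * deriv \<phi> x \<partial>dom_measure \<Omega>) = - (\<integral>x. h x * \<phi> x \<partial>dom_measure \<Omega>)"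
proof -
  have s: "smooth_fun \<phi>" by (rule test_fun_smooth[OF \<phi>])
  have hm: "h \<in> borel_measurable borel" using uh by (simp add: weak_derivative_def square_integrable_dom_def)
  have parts: "(LINT x:{a..b}|lborel. H x * deriv \<phi> x) = H b * \<phi> b - H a * \<phi> a - (LINT x:{a..b}|lborel. h x * \<phi> x)"
    if "a \<le> b" for a b
    by (rule indefinite_integral_by_parts[OF H hm smooth_fun_deriv[OF s] smooth_fun_continuous[OF smooth_fun_deriv_smooth[OF s]] that])
  show ?thesis
  proof (cases \<Omega>)
    case Line
    obtain B1 where B1: "B1 > 0" "\<And>x. B1 \<le> \<bar>x\<bar> \<Longrightarrow> \<phi> x = 0"
      using test_fun_bound[OF \<phi>] Line by (metis dom_set_def domain.case(1) UNIV_I)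
    obtain B2 where B2: "\<And>x. B2 \<le> \<bar>x\<bar> \<Longrightarrow> deriv \<phi> x = 0"
      using test_fun_bound[OF test_fun_deriv[OF \<phi>]] Line by (metis dom_set_def domain.case(1) UNIV_I)
    define B where "B = max B1 B2"
    have B: "\<phi> x = 0" "deriv \<phi> x = 0" if "B \<le> \<bar>x\<bar>" for x
      using B1(2)[of x] B2[of x] that by (auto simp: B_def)
    have B0: "B > 0" using B1(1) by (auto simp: B_def)
    have restr: "(LINT x:UNIV|lborel. f x) = (LINT x:{-B..B}|lborel. f x)"
      if "\<And>x. B \<le> \<bar>x\<bar> \<Longrightarrow> f x = 0" for f :: "real \<Rightarrow> real"
      unfolding set_lebesgue_integral_def
    proof (intro Bochner_Integration.integral_cong refl)
      fix x show "indicator UNIV x *\<^sub>R f x = indicator {-B..B} x *\<^sub>R f x"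
        using that[of x] by (cases "x \<in> {-B..B}") auto
    qed
    have "(LINT x:UNIV|lborel. H x * deriv \<phi> x) = (LINT x:{-B..B}|lborel. H x * deriv \<phi> x)"
      by (rule restr) (use B in simp)
    also have "\<dots> = - (LINT x:{-B..B}|lborel. h x * \<phi> x)"
      using parts[of "-B" B] B0 B(1)[of B] B(1)[of "-B"] by simp
    also have "(LINT x:{-B..B}|lborel. h x * \<phi> x) = (LINT x:UNIV|lborel. h x * \<phi> x)"
      by (rule restr[symmetric]) (use B in simp)
    finally show ?thesis using Line by (simp add: integral_dom dom_set_def)
  next
    case Torus
    have "\<phi> (0 + 2 * pi) = \<phi> 0" using \<phi> Torus unfolding test_fun_def by (simp del: add_0)
    moreover have "H (0 + 2 * pi) = H 0"
      using weak_derivative_indefinite_integral_periodic[OF _ H] uh Torus by blast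
    ultimately show ?thesis using parts[of 0 "2 * pi"] Torus by (simp add: integral_dom dom_set_def)
  qed
qed

theorem weak_derivative_representation:
  assumes uh: "weak_derivative \<Omega> u h"
  obtains G where "indefinite_integral h G" "AE x in lborel. u x = G x"
proof -
  have u: "square_integrable_dom \<Omega> u" and h: "square_integrable_dom \<Omega> h"
    using uh by (auto simp: weak_derivative_def)
  have [measurable]: "u \<in> borel_measurable borel" using u by (simp add: square_integrable_dom_def)
  obtain H where H: "indefinite_integral h H"
    using ex_indefinite_integral[OF square_integrable_dom_integrable_Icc[OF h]] by blast
  have cH: "continuous_on S H" for S by (rule indefinite_integral_continuous[OF H])
  have [measurable]: "H \<in> borel_measurable borel" by (rule borel_measurable_continuous_onI[OF cH])
  have locH: "set_integrable lborel ({p..q} \<inter> dom_set \<Omega>) H" for p q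
    by (rule set_integrable_subset[OF borel_integrable_atLeastAtMost'[of p q, OF cH]]) auto
  have locu: "set_integrable lborel ({p..q} \<inter> dom_set \<Omega>) u" for p q
    by (rule square_integrable_dom_locally_integrable[OF u])
  have "\<exists>c. AE x in dom_measure \<Omega>. u x - H x = c"
  proof (rule AE_const_if_test_deriv_integrals_zero)
    show "set_integrable lborel ({p..q} \<inter> dom_set \<Omega>) (\<lambda>x. u x - H x)" for p q
      by (intro set_integral_diff(1) locu locH)
    fix \<phi> assume \<phi>: "test_fun \<Omega> \<phi>"
    have "integrable (dom_measure \<Omega>) (\<lambda>x. u x * deriv \<phi> x)" "integrable (dom_measure \<Omega>) (\<lambda>x. H x * deriv \<phi> x)"
      unfolding integrable_dom by (intro test_fun_mult_integrable locu locH test_fun_deriv[OF \<phi>]; simp)+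
    then show "(\<integral>x. (u x - H x) * deriv \<phi> x \<partial>dom_measure \<Omega>) = 0"
      using weak_derivative_integration_by_parts[OF uh H \<phi>] uh \<phi>
      by (simp add: left_diff_distrib weak_derivative_def)
  qed simp
  then obtain c where c: "AE x in dom_measure \<Omega>. u x - H x = c" by blast
  have "AE x in lborel. u x - H x = c"
    using weak_derivative_indefinite_integral_periodic[OF _ H] uh square_integrable_dom_periodic[OF u]
    by (intro AE_lborel_if_AE_dom[OF c]) auto
  then have "AE x in lborel. u x = H x + c" by eventually_elim auto
  moreover have "indefinite_integral h (\<lambda>x. H x + c)" using H by (simp add: indefinite_integral_def)
  ultimately show ?thesis using that by blast
qed

subsection \<open>Sobolev estimates\<close>

lemma square_integrable_dom_subset:
  assumes g: "square_integrable_dom \<Omega> g" and I: "I \<subseteq> dom_set \<Omega>" "I \<in> sets borel"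
  shows "integrable (restrict_space lborel I) (\<lambda>x. (g x)\<^sup>2)"
    "(\<integral>x. (g x)\<^sup>2 \<partial>restrict_space lborel I) \<le> (\<integral>x. (g x)\<^sup>2 \<partial>dom_measure \<Omega>)"
proof -
  have d: "set_integrable lborel (dom_set \<Omega>) (\<lambda>x. (g x)\<^sup>2)"
    using g by (simp add: square_integrable_dom_def integrable_dom)
  then have i: "set_integrable lborel I (\<lambda>x. (g x)\<^sup>2)"
    by (rule set_integrable_subset) (use I in auto)
  then show "integrable (restrict_space lborel I) (\<lambda>x. (g x)\<^sup>2)"
    using I(2) by (simp add: integrable_restrict_space set_integrable_def)
  have "(\<integral>x. indicator I x *\<^sub>R (g x)\<^sup>2 \<partial>lborel) \<le> (\<integral>x. indicator (dom_set \<Omega>) x *\<^sub>R (g x)\<^sup>2 \<partial>lborel)"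
    using d i I(1) unfolding set_integrable_def by (intro integral_mono) (auto simp: indicator_def)
  then show "(\<integral>x. (g x)\<^sup>2 \<partial>restrict_space lborel I) \<le> (\<integral>x. (g x)\<^sup>2 \<partial>dom_measure \<Omega>)"
    using I(2) by (simp add: integral_restrict_space integral_dom set_lebesgue_integral_def)
qed

text \<open>On a unit interval the value at one point differs from the value at any other point by at most
  the square root of the integral of \<open>h\<^sup>2\<close>; averaging over the second point gives the bound.\<close>

lemma weak_derivative_sup_bound:
  assumes uh: "weak_derivative \<Omega> u h"
  shows "AE x in lborel. (u x)\<^sup>2 \<le> 2 * ((\<integral>x. (u x)\<^sup>2 \<partial>dom_measure \<Omega>) + (\<integral>x. (h x)\<^sup>2 \<partial>dom_measure \<Omega>))"
proof -
  let ?C = "2 * ((\<integral>x. (u x)\<^sup>2 \<partial>dom_measure \<Omega>) + (\<integral>x. (h x)\<^sup>2 \<partial>dom_measure \<Omega>))"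
  have u: "square_integrable_dom \<Omega> u" and h: "square_integrable_dom \<Omega> h"
    using uh by (auto simp: weak_derivative_def)
  obtain G where G: "indefinite_integral h G" "AE x in lborel. u x = G x"
    using weak_derivative_representation[OF uh] by blast
  have bound: "(G x)\<^sup>2 \<le> ?C" if x: "x \<in> dom_set \<Omega>" for x
  proof -
    \<comment> \<open>The period is longer than 6, so a unit interval fits to the right of x or, in
      the second half of the period, to its left.\<close>
    obtain a where a: "x \<in> {a..a + 1}" "{a..a + 1} \<subseteq> dom_set \<Omega>"
    proof (cases \<Omega>)
      case Line
      show ?thesis by (rule that[of x]) (use Line in \<open>auto simp: dom_set_def\<close>)
    next
      case Torus
      show ?thesis by (rule that[of "if x \<le> pi then x else x - 1"])
        (use Torus x pi_gt3 in \<open>auto simp: dom_set_def\<close>)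
    qed
    define N where "N = restrict_space lborel {a..a + 1}"
    interpret N: prob_space N
      by (rule prob_spaceI) (simp add: N_def emeasure_restrict_space space_restrict_space)
    have ih: "set_integrable lborel {a..a + 1} h" by (rule square_integrable_dom_integrable_Icc[OF h])
    then have iN: "integrable N h" by (simp add: N_def integrable_restrict_space set_integrable_def)
    define m where "m = N.expectation (\<lambda>y. \<bar>h y\<bar>)"
    have sub: "\<bar>G q - G p\<bar> \<le> m" if "a \<le> p" "p \<le> q" "q \<le> a + 1" for p q
    proof -
      have i: "set_integrable lborel {p..q} h" by (rule square_integrable_dom_integrable_Icc[OF h])
      have "\<bar>G q - G p\<bar> \<le> (\<integral>y. \<bar>indicator {p..q} y *\<^sub>R h y\<bar> \<partial>lborel)"
        unfolding indefinite_integralD(2)[OF G(1) that(2)] set_lebesgue_integral_def by (rule integral_abs_bound)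
      also have "\<dots> \<le> (\<integral>y. \<bar>indicator {a..a + 1} y *\<^sub>R h y\<bar> \<partial>lborel)"
        using i ih that unfolding set_integrable_def
        by (intro integral_mono integrable_abs) (auto simp: indicator_def)
      also have "\<dots> = m"
        by (simp add: m_def N_def integral_restrict_space abs_mult)
      finally show ?thesis .
    qed
    \<comment> \<open>Nonnegativity of the variance serves as the Cauchy-Schwarz inequality on the
      unit interval.\<close>
    have "N.variance (\<lambda>y. \<bar>h y\<bar>) = N.expectation (\<lambda>y. \<bar>h y\<bar>\<^sup>2) - m\<^sup>2"
      unfolding m_def using iN square_integrable_dom_subset(1)[OF h a(2)]
      by (intro N.variance_eq) (auto simp: N_def)
    then have "m\<^sup>2 \<le> N.expectation (\<lambda>y. (h y)\<^sup>2)"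
      using N.variance_positive[of "\<lambda>y. \<bar>h y\<bar>"] by simp
    also have "\<dots> \<le> (\<integral>x. (h x)\<^sup>2 \<partial>dom_measure \<Omega>)"
      unfolding N_def by (rule square_integrable_dom_subset(2)[OF h a(2)]) simp
    finally have m2: "m\<^sup>2 \<le> (\<integral>x. (h x)\<^sup>2 \<partial>dom_measure \<Omega>)" .
    have iu: "integrable N (\<lambda>y. (u y)\<^sup>2)"
      unfolding N_def by (rule square_integrable_dom_subset(1)[OF u a(2)]) simp
    have "AE y in N. u y = G y" using G(2) unfolding N_def
      by (subst AE_restrict_space_iff) auto
    moreover have "AE y in N. y \<in> {a..a + 1}" unfolding N_def
      by (subst AE_restrict_space_iff) auto
    ultimately have "AE y in N. (G x)\<^sup>2 \<le> 2 * (u y)\<^sup>2 + 2 * m\<^sup>2"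
    proof eventually_elim
      case (elim y)
      have "\<bar>G x - G y\<bar> \<le> m" using sub[of x y] sub[of y x] elim(2) a(1) by (cases "x \<le> y") (auto simp: abs_minus_commute)
      then have "(G x - G y)\<^sup>2 \<le> m\<^sup>2" by (metis abs_ge_zero power2_abs power_mono)
      moreover have "(G x)\<^sup>2 + (G x - 2 * G y)\<^sup>2 = 2 * (G y)\<^sup>2 + 2 * (G x - G y)\<^sup>2"
        by (simp add: power2_eq_square algebra_simps)
      moreover have "(G x - 2 * G y)\<^sup>2 \<ge> 0" by simp
      ultimately show ?case unfolding elim(1) by linarith
    qed
    then have "N.expectation (\<lambda>_. (G x)\<^sup>2) \<le> N.expectation (\<lambda>y. 2 * (u y)\<^sup>2 + 2 * m\<^sup>2)"
      using iu by (intro integral_mono_AE) auto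
    also have "\<dots> = 2 * N.expectation (\<lambda>y. (u y)\<^sup>2) + 2 * m\<^sup>2" using iu N.prob_space by simp
    also have "\<dots> \<le> ?C"
    proof -
      have "N.expectation (\<lambda>y. (u y)\<^sup>2) \<le> (\<integral>x. (u x)\<^sup>2 \<partial>dom_measure \<Omega>)"
        unfolding N_def by (rule square_integrable_dom_subset(2)[OF u a(2)]) simp
      then show ?thesis using m2 by simp
    qed
    finally show ?thesis using N.prob_space by simp
  qed
  have "AE x in dom_measure \<Omega>. (u x)\<^sup>2 \<le> ?C" unfolding AE_dom using G(2)
    by eventually_elim (use bound in simp)
  then show ?thesis
    by (rule AE_lborel_if_AE_dom) (simp add: square_integrable_dom_periodic[OF u])
qed

section \<open>Chosen weak derivatives of functions in H^k\<close>

lemma is_wderiv_square_integrable: "is_wderiv \<Omega> j g h \<Longrightarrow> square_integrable_dom \<Omega> h"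
  by (simp add: is_wderiv_def square_integrable_dom_def)

lemma in_Hk_square_integrable: "in_Hk \<Omega> k g \<Longrightarrow> square_integrable_dom \<Omega> g"
  by (simp add: in_Hk_def square_integrable_dom_def)

lemma in_Hk_wderiv:
  assumes "in_Hk \<Omega> k g" "j \<le> k"
  shows "is_wderiv \<Omega> j g (wderiv \<Omega> j g)"
proof -
  have "\<exists>h. is_wderiv \<Omega> j g h" using assms by (simp add: in_Hk_def)
  then show ?thesis unfolding wderiv_def by (rule someI_ex)
qed

lemma test_fun_iterated_deriv: "test_fun \<Omega> \<phi> \<Longrightarrow> test_fun \<Omega> ((deriv ^^ j) \<phi>)"
  by (induction j) (auto intro: test_fun_deriv)

text \<open>The derivatives of orders j and j + 1 are chosen independently of each other. Testing g
  with the iterated derivatives of \<phi>' and of \<phi> links them.\<close>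

lemma weak_derivative_wderiv:
  assumes "is_wderiv \<Omega> j g h" "is_wderiv \<Omega> (Suc j) g h'"
  shows "weak_derivative \<Omega> h h'"
  unfolding weak_derivative_def
proof (intro conjI allI impI)
  fix \<phi> assume \<phi>: "test_fun \<Omega> \<phi>"
  have "(\<integral>x. g x * (deriv ^^ j) (deriv \<phi>) x \<partial>dom_measure \<Omega>) = (-1) ^ j * (\<integral>x. h x * deriv \<phi> x \<partial>dom_measure \<Omega>)"
    using assms(1) test_fun_deriv[OF \<phi>] unfolding is_wderiv_def by blast
  moreover have "(\<integral>x. g x * (deriv ^^ Suc j) \<phi> x \<partial>dom_measure \<Omega>) = (-1) ^ Suc j * (\<integral>x. h' x * \<phi> x \<partial>dom_measure \<Omega>)"
    using assms(2) \<phi> unfolding is_wderiv_def by blast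
  moreover have "(deriv ^^ Suc j) \<phi> = (deriv ^^ j) (deriv \<phi>)" by (simp add: funpow_swap1)
  ultimately have "(-1) ^ j * (\<integral>x. h x * deriv \<phi> x \<partial>dom_measure \<Omega>) = (-1) ^ j * (- (\<integral>x. h' x * \<phi> x \<partial>dom_measure \<Omega>))"
    by simp
  then show "(\<integral>x. h x * deriv \<phi> x \<partial>dom_measure \<Omega>) = - (\<integral>x. h' x * \<phi> x \<partial>dom_measure \<Omega>)"
    by (simp only: mult_cancel_left power_eq_0_iff) simp
qed (use assms is_wderiv_square_integrable in auto)

lemma is_wderiv_0: "square_integrable_dom \<Omega> g \<Longrightarrow> is_wderiv \<Omega> 0 g g"
  by (simp add: is_wderiv_def square_integrable_dom_def)

lemma is_wderiv_AE_unique: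
  assumes "is_wderiv \<Omega> j g h" "is_wderiv \<Omega> j g h'"
  shows "AE x in dom_measure \<Omega>. h x = h' x"
proof -
  have s: "square_integrable_dom \<Omega> h" "square_integrable_dom \<Omega> h'"
    using assms is_wderiv_square_integrable by auto
  have [measurable]: "h \<in> borel_measurable borel" "h' \<in> borel_measurable borel"
    using s by (auto simp: square_integrable_dom_def)
  have "AE x in dom_measure \<Omega>. h x - h' x = 0"
  proof (rule AE_zero_if_test_integrals_zero)
    show "set_integrable lborel ({p..q} \<inter> dom_set \<Omega>) (\<lambda>x. h x - h' x)" for p q
      by (intro set_integral_diff(1) square_integrable_dom_locally_integrable s)
    fix \<phi> assume \<phi>: "test_fun \<Omega> \<phi>"
    have "integrable (dom_measure \<Omega>) (\<lambda>x. h x * \<phi> x)" "integrable (dom_measure \<Omega>) (\<lambda>x. h' x * \<phi> x)"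
      unfolding integrable_dom
      by (intro test_fun_mult_integrable square_integrable_dom_locally_integrable s \<phi>; simp)+
    moreover have "(\<integral>x. g x * (deriv ^^ j) \<phi> x \<partial>dom_measure \<Omega>) = (-1) ^ j * (\<integral>x. h x * \<phi> x \<partial>dom_measure \<Omega>)"
      using assms(1) \<phi> unfolding is_wderiv_def by blast
    moreover have "(\<integral>x. g x * (deriv ^^ j) \<phi> x \<partial>dom_measure \<Omega>) = (-1) ^ j * (\<integral>x. h' x * \<phi> x \<partial>dom_measure \<Omega>)"
      using assms(2) \<phi> unfolding is_wderiv_def by blast
    ultimately show "(\<integral>x. (h x - h' x) * \<phi> x \<partial>dom_measure \<Omega>) = 0"
      by (simp add: left_diff_distrib)
  qed simp
  then show ?thesis by auto
qed

text \<open>Only the orders 0 and 1 of the norm are used. The zeroth chosen derivative is merely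
  a.e. equal to g, whence the appeal to uniqueness. The constant 2 is sqrt 2 rounded up.\<close>

theorem Sobolev_bound:
  assumes g: "in_Hk \<Omega> k g" and k: "k \<ge> 1"
  shows "AE x in lborel. \<bar>g x\<bar> \<le> 2 * Hk_norm \<Omega> k g"
proof -
  have s: "square_integrable_dom \<Omega> g" by (rule in_Hk_square_integrable[OF g])
  have 1: "is_wderiv \<Omega> (Suc 0) g (wderiv \<Omega> 1 g)" using in_Hk_wderiv[OF g, of 1] k by simp
  have 0: "is_wderiv \<Omega> 0 g (wderiv \<Omega> 0 g)" using in_Hk_wderiv[OF g, of 0] by simp
  let ?n = "\<lambda>j. \<integral>x. (wderiv \<Omega> j g x)\<^sup>2 \<partial>dom_measure \<Omega>"
  have ae: "AE x in dom_measure \<Omega>. g x = wderiv \<Omega> 0 g x"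
    by (rule is_wderiv_AE_unique[OF is_wderiv_0[OF s] 0])
  have bm: "(\<lambda>x. f x) \<in> borel_measurable (dom_measure \<Omega>)" if "square_integrable_dom \<Omega> f" for f
    using that unfolding dom_measure_eq square_integrable_dom_def by (auto intro: measurable_restrict_space1)
  have "(\<integral>x. (g x)\<^sup>2 \<partial>dom_measure \<Omega>) = ?n 0"
    using ae bm[OF s] bm[OF is_wderiv_square_integrable[OF 0]]
    by (intro integral_cong_AE) (auto elim: eventually_mono)
  moreover have "?n 0 + ?n 1 \<le> (\<Sum>j\<le>k. ?n j)"
  proof -
    have "(\<Sum>j\<in>{0,1}. ?n j) \<le> (\<Sum>j\<le>k. ?n j)"
      by (rule sum_mono2) (use k in auto)
    then show ?thesis by simp
  qed
  moreover have "(Hk_norm \<Omega> k g)\<^sup>2 = (\<Sum>j\<le>k. ?n j)"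
    unfolding Hk_norm_def by (simp add: sum_nonneg)
  moreover have "AE x in lborel. (g x)\<^sup>2 \<le> 2 * ((\<integral>x. (g x)\<^sup>2 \<partial>dom_measure \<Omega>) + ?n 1)"
    by (rule weak_derivative_sup_bound[OF weak_derivative_wderiv[OF is_wderiv_0[OF s] 1]])
  ultimately have "AE x in lborel. (g x)\<^sup>2 \<le> 2 * (Hk_norm \<Omega> k g)\<^sup>2"
    by (auto elim!: eventually_mono)
  then show ?thesis
  proof eventually_elim
    case (elim x)
    have "0 \<le> Hk_norm \<Omega> k g" unfolding Hk_norm_def by (simp add: sum_nonneg)
    moreover have "\<bar>g x\<bar>\<^sup>2 \<le> (2 * Hk_norm \<Omega> k g)\<^sup>2"
    proof -
      have "(2 * Hk_norm \<Omega> k g)\<^sup>2 = 4 * (Hk_norm \<Omega> k g)\<^sup>2" by (simp add: power_mult_distrib)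
      then show ?thesis using elim zero_le_power2[of "Hk_norm \<Omega> k g"] unfolding power2_abs by linarith
    qed
    ultimately show ?case by (intro power2_le_imp_le[of "\<bar>g x\<bar>"]) auto
  qed
qed

lemma AE_bounded_if_weak_derivative:
  assumes "weak_derivative \<Omega> u h"
  obtains C where "C \<ge> 0" "AE x in lborel. \<bar>u x\<bar> \<le> C"
proof -
  let ?C = "2 * ((\<integral>x. (u x)\<^sup>2 \<partial>dom_measure \<Omega>) + (\<integral>x. (h x)\<^sup>2 \<partial>dom_measure \<Omega>))"
  have "AE x in lborel. \<bar>u x\<bar> \<le> sqrt ?C"
    using weak_derivative_sup_bound[OF assms] by eventually_elim (rule real_le_rsqrt, simp)
  then show ?thesis by (intro that[of "sqrt ?C"]) auto
qed

text \<open>The third weak derivative bounds the second, so the representative D of the first is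
  Lipschitz. F is a primitive of the first weak derivative, which may be replaced by the continuous
  D under the integral; hence F is differentiable everywhere.\<close>

theorem in_Hk_regular_representative:
  assumes g: "in_Hk \<Omega> k g" and k: "k \<ge> 3"
  obtains F D where "\<And>x. (F has_real_derivative D x) (at x)"
    "\<exists>M. \<forall>x. \<bar>F x\<bar> \<le> M" "\<exists>K. \<forall>x y. \<bar>D x - D y\<bar> \<le> K * \<bar>x - y\<bar>"
    "AE x in lborel. g x = F x" "AE x in lborel. wderiv \<Omega> 1 g x = D x"
proof -
  have s: "square_integrable_dom \<Omega> g" by (rule in_Hk_square_integrable[OF g])
  have w: "is_wderiv \<Omega> j g (wderiv \<Omega> j g)" if "j \<le> 3" for j using in_Hk_wderiv[OF g] that k by simp
  have w01: "weak_derivative \<Omega> g (wderiv \<Omega> 1 g)"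
    by (rule weak_derivative_wderiv[OF is_wderiv_0[OF s]]) (use w[of 1] in simp)
  have w12: "weak_derivative \<Omega> (wderiv \<Omega> 1 g) (wderiv \<Omega> 2 g)"
    by (rule weak_derivative_wderiv[of _ 1 g]) (use w[of 1] w[of 2] in \<open>simp_all add: numeral_2_eq_2\<close>)
  have w23: "weak_derivative \<Omega> (wderiv \<Omega> 2 g) (wderiv \<Omega> 3 g)"
    by (rule weak_derivative_wderiv[of _ 2 g]) (use w[of 2] w[of 3] in \<open>simp_all add: eval_nat_numeral\<close>)
  obtain F where F: "indefinite_integral (wderiv \<Omega> 1 g) F" "AE x in lborel. g x = F x"
    using weak_derivative_representation[OF w01] by blast
  obtain D where D: "indefinite_integral (wderiv \<Omega> 2 g) D" "AE x in lborel. wderiv \<Omega> 1 g x = D x"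
    using weak_derivative_representation[OF w12] by blast
  obtain K where K: "K \<ge> 0" "AE x in lborel. \<bar>wderiv \<Omega> 2 g x\<bar> \<le> K"
    using AE_bounded_if_weak_derivative[OF w23] by blast
  obtain M where M: "AE x in lborel. \<bar>g x\<bar> \<le> M"
    using AE_bounded_if_weak_derivative[OF w01] by blast
  have cF: "continuous_on UNIV F" and cD: "continuous_on UNIV D"
    using indefinite_integral_continuous F(1) D(1) by blast+
  have [measurable]: "D \<in> borel_measurable borel" "wderiv \<Omega> (Suc 0) g \<in> borel_measurable borel"
    using borel_measurable_continuous_onI[OF cD] w[of 1] by (simp_all add: is_wderiv_def)
  show ?thesis
  proof (rule that[of F D])
    fix x
    obtain \<Phi> where \<Phi>: "\<And>x. (\<Phi> has_real_derivative D x) (at x)" using ex_antiderivative[OF cD] by blast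
    have eq: "F y - F x = \<Phi> y - \<Phi> x" if "x \<le> y" for x y
    proof -
      have "F y - F x = (LINT z:{x..y}|lborel. wderiv \<Omega> 1 g z)" by (rule indefinite_integralD(2)[OF F(1) that])
      also have "\<dots> = (LINT z:{x..y}|lborel. D z)"
        by (intro set_lebesgue_integral_cong_AE) (use D(2) in \<open>auto elim: eventually_mono\<close>)
      also have "\<dots> = \<Phi> y - \<Phi> x" by (rule FTC_set_integral[OF \<Phi> cD that])
      finally show ?thesis .
    qed
    have "F = (\<lambda>y. \<Phi> y + (F 0 - \<Phi> 0))"
    proof
      fix y show "F y = \<Phi> y + (F 0 - \<Phi> 0)" using eq[of 0 y] eq[of y 0] by (cases "0 \<le> y") auto
    qed
    moreover have "((\<lambda>y. \<Phi> y + (F 0 - \<Phi> 0)) has_real_derivative D x) (at x)"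
      using \<Phi> by (auto intro!: derivative_eq_intros)
    ultimately show "(F has_real_derivative D x) (at x)" by simp
  next
    have "AE x in lborel. \<bar>F x\<bar> \<le> M" using M F(2) by eventually_elim simp
    then have "\<bar>F x\<bar> \<le> M" for x
      by (rule continuous_le_if_AE_le[rotated 2]) (intro continuous_intros cF)+
    then show "\<exists>M. \<forall>x. \<bar>F x\<bar> \<le> M" by blast
  next
    have "\<bar>D y - D x\<bar> \<le> K * \<bar>y - x\<bar>" if "x \<le> y" for x y
    proof -
      have i: "set_integrable lborel {x..y} (wderiv \<Omega> 2 g)" by (rule indefinite_integralD(1)[OF D(1) that])
      have "\<bar>D y - D x\<bar> \<le> (\<integral>z. \<bar>indicator {x..y} z *\<^sub>R wderiv \<Omega> 2 g z\<bar> \<partial>lborel)"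
        unfolding indefinite_integralD(2)[OF D(1) that] set_lebesgue_integral_def by (rule integral_abs_bound)
      also have "\<dots> \<le> (\<integral>z. indicator {x..y} z *\<^sub>R K \<partial>lborel)"
      proof (rule integral_mono_AE)
        show "integrable lborel (\<lambda>z. \<bar>indicator {x..y} z *\<^sub>R wderiv \<Omega> 2 g z\<bar>)"
          using i unfolding set_integrable_def by (rule integrable_abs)
        show "integrable lborel (\<lambda>z. indicator {x..y} z *\<^sub>R K)"
          using borel_integrable_atLeastAtMost'[OF continuous_on_const, of x y K] unfolding set_integrable_def .
        show "AE z in lborel. \<bar>indicator {x..y} z *\<^sub>R wderiv \<Omega> 2 g z\<bar> \<le> indicator {x..y} z *\<^sub>R K"
          using K(2) by eventually_elim (auto simp: indicator_def)
      qed
      also have "\<dots> = K * \<bar>y - x\<bar>" using that by simp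
      finally show ?thesis .
    qed
    then have "\<bar>D x - D y\<bar> \<le> K * \<bar>x - y\<bar>" for x y
      by (cases "x \<le> y") (metis abs_minus_commute, metis linear)
    then show "\<exists>K. \<forall>x y. \<bar>D x - D y\<bar> \<le> K * \<bar>x - y\<bar>" by blast
  qed (rule F(2), rule D(2))
qed

subsection \<open>The maximum principle\<close>

lemma square_integrable_dom_lincomb:
  assumes f: "square_integrable_dom \<Omega> f" and g: "square_integrable_dom \<Omega> g"
  shows "square_integrable_dom \<Omega> (\<lambda>x. a * f x + b * g x)"
proof -
  have [measurable]: "f \<in> borel_measurable borel" "g \<in> borel_measurable borel"
    using f g by (auto simp: square_integrable_dom_def)
  have "integrable (dom_measure \<Omega>) (\<lambda>x. 2 * a\<^sup>2 * (f x)\<^sup>2 + 2 * b\<^sup>2 * (g x)\<^sup>2)"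
    using f g by (auto simp: square_integrable_dom_def)
  then have "integrable (dom_measure \<Omega>) (\<lambda>x. (a * f x + b * g x)\<^sup>2)"
  proof (rule Bochner_Integration.integrable_bound)
    show "(\<lambda>x. (a * f x + b * g x)\<^sup>2) \<in> borel_measurable (dom_measure \<Omega>)"
      unfolding dom_measure_eq by (rule measurable_restrict_space1) simp
    have "norm ((a * f x + b * g x)\<^sup>2) \<le> norm (2 * a\<^sup>2 * (f x)\<^sup>2 + 2 * b\<^sup>2 * (g x)\<^sup>2)" for x
    proof -
      have "(a * f x + b * g x)\<^sup>2 \<le> 2 * a\<^sup>2 * (f x)\<^sup>2 + 2 * b\<^sup>2 * (g x)\<^sup>2"
        using zero_le_power2[of "a * f x - b * g x"] by (simp add: power2_eq_square algebra_simps)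
      then show ?thesis unfolding real_norm_def abs_of_nonneg[OF zero_le_power2] by linarith
    qed
    then show "AE x in dom_measure \<Omega>. norm ((a * f x + b * g x)\<^sup>2) \<le> norm (2 * a\<^sup>2 * (f x)\<^sup>2 + 2 * b\<^sup>2 * (g x)\<^sup>2)"
      by (intro AE_I2)
  qed
  then show ?thesis using f g
    by (auto simp: square_integrable_dom_def admissible_def split: domain.splits)
qed

lemma square_integrable_dom_mult_test_fun:
  assumes g: "square_integrable_dom \<Omega> g" and \<phi>: "test_fun \<Omega> \<phi>"
  shows "integrable (dom_measure \<Omega>) (\<lambda>x. g x * \<phi> x)"
  unfolding integrable_dom
  by (rule test_fun_mult_integrable[OF _ square_integrable_dom_locally_integrable[OF g] \<phi>])
    (use g in \<open>simp add: square_integrable_dom_def\<close>)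

lemma is_wderiv_lincomb:
  assumes f: "square_integrable_dom \<Omega> f" "is_wderiv \<Omega> j f f'"
    and g: "square_integrable_dom \<Omega> g" "is_wderiv \<Omega> j g g'"
  shows "is_wderiv \<Omega> j (\<lambda>x. a * f x + b * g x) (\<lambda>x. a * f' x + b * g' x)"
proof -
  have f': "square_integrable_dom \<Omega> f'" and g': "square_integrable_dom \<Omega> g'"
    using f g is_wderiv_square_integrable by auto
  have lin: "(\<integral>x. (a * p x + b * q x) * \<phi> x \<partial>dom_measure \<Omega>) =
      a * (\<integral>x. p x * \<phi> x \<partial>dom_measure \<Omega>) + b * (\<integral>x. q x * \<phi> x \<partial>dom_measure \<Omega>)"
    if "square_integrable_dom \<Omega> p" "square_integrable_dom \<Omega> q" "test_fun \<Omega> \<phi>" for p q \<phi>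
    using square_integrable_dom_mult_test_fun[OF that(1,3)] square_integrable_dom_mult_test_fun[OF that(2,3)]
    by (simp add: distrib_right mult.assoc)
  have "(\<integral>x. (a * f x + b * g x) * (deriv ^^ j) \<phi> x \<partial>dom_measure \<Omega>) =
      (- 1) ^ j * (\<integral>x. (a * f' x + b * g' x) * \<phi> x \<partial>dom_measure \<Omega>)" if \<phi>: "test_fun \<Omega> \<phi>" for \<phi>
  proof -
    have "(\<integral>x. f x * (deriv ^^ j) \<phi> x \<partial>dom_measure \<Omega>) = (- 1) ^ j * (\<integral>x. f' x * \<phi> x \<partial>dom_measure \<Omega>)"
      using f(2) \<phi> unfolding is_wderiv_def by blast
    moreover have "(\<integral>x. g x * (deriv ^^ j) \<phi> x \<partial>dom_measure \<Omega>) = (- 1) ^ j * (\<integral>x. g' x * \<phi> x \<partial>dom_measure \<Omega>)"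
      using g(2) \<phi> unfolding is_wderiv_def by blast
    ultimately show ?thesis
      unfolding lin[OF f(1) g(1) test_fun_iterated_deriv[OF \<phi>]] lin[OF f' g' \<phi>] by (simp add: distrib_left)
  qed
  then show ?thesis using square_integrable_dom_lincomb[OF f' g', of a b]
    by (simp add: is_wderiv_def square_integrable_dom_def)
qed

text \<open>\<open>Hk_norm\<close> is built from a choice of weak derivatives and is meaningful only
  for members of H^k. This lemma supplies membership for the remainder of the difference
  quotient.\<close>

lemma in_Hk_lincomb:
  assumes f: "in_Hk \<Omega> k f" and g: "in_Hk \<Omega> k g"
  shows "in_Hk \<Omega> k (\<lambda>x. a * f x + b * g x)"
proof -
  note s = in_Hk_square_integrable[OF f] in_Hk_square_integrable[OF g]
  have "\<exists>h. is_wderiv \<Omega> j (\<lambda>x. a * f x + b * g x) h" if "j \<le> k" for j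
    using is_wderiv_lincomb[OF s(1) in_Hk_wderiv[OF f that] s(2) in_Hk_wderiv[OF g that]] by blast
  then show ?thesis using square_integrable_dom_lincomb[OF s, of a b]
    by (simp add: in_Hk_def square_integrable_dom_def)
qed

section \<open>Principal values under null-set changes and change of sign\<close>

lemma has_PV_cong_AE:
  assumes "has_PV h L" and [measurable]: "h \<in> borel_measurable borel" "h' \<in> borel_measurable borel"
    and ae: "AE \<alpha> in lborel. h \<alpha> = h' \<alpha>"
  shows "has_PV h' L"
proof -
  have "set_integrable lborel {-R..R} h = set_integrable lborel {-R..R} h'" for R
    by (intro set_integrable_cong_AE) (use ae in \<open>auto elim: eventually_mono\<close>)
  moreover have "set_lebesgue_integral lborel {-R..R} h = set_lebesgue_integral lborel {-R..R} h'" for R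
    by (intro set_lebesgue_integral_cong_AE) (use ae in \<open>auto elim: eventually_mono\<close>)
  ultimately show ?thesis using assms(1) by (simp add: has_PV_def)
qed

lemma has_PV_uminus: "has_PV h L \<Longrightarrow> has_PV (\<lambda>\<alpha>. - h \<alpha>) (- L)"
  by (auto simp: has_PV_def set_integrable_def set_lebesgue_integral_def intro: tendsto_minus)

lemma muskat_kernel_uminus: "muskat_kernel (\<lambda>x. - F x) (\<lambda>x. - D x) x \<alpha> = - muskat_kernel F D x \<alpha>"
proof -
  have "(- F x + F (x - \<alpha>))\<^sup>2 = (F x - F (x - \<alpha>))\<^sup>2" by (simp add: power2_eq_square algebra_simps)
  then show ?thesis
    unfolding muskat_kernel_def by (simp add: minus_divide_left algebra_simps)
qed

lemma muskat_kernel_measurable: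
  assumes [measurable]: "F \<in> borel_measurable borel" "D \<in> borel_measurable borel"
  shows "muskat_kernel F D x \<in> borel_measurable borel"
proof -
  have "muskat_kernel F D x = (\<lambda>\<alpha>. (D x - D (x - \<alpha>)) * \<alpha> / (\<alpha>\<^sup>2 + (F x - F (x - \<alpha>))\<^sup>2))"
    by (simp add: fun_eq_iff muskat_kernel_def)
  also have "\<dots> \<in> borel_measurable borel" by measurable
  finally show ?thesis .
qed

text \<open>Two layers of null sets occur: x must be a point where the representatives agree with f
  and its weak derivative, and for such x the same must hold at x - \<alpha> for almost every
  \<alpha>. On the torus the whole condition is periodic in x, so it extends to R.\<close>

lemma muskat_integrand_AE_kernel:
  assumes f: "in_Hk \<Omega> k (\<lambda>x. f x t)" and k: "k \<ge> 3"
    and F: "\<And>x. (F has_real_derivative D x) (at x)" and lip: "\<exists>K. \<forall>x y. \<bar>D x - D y\<bar> \<le> K * \<bar>x - y\<bar>"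
    and aeF: "AE x in lborel. f x t = F x" and aeD: "AE x in lborel. wderiv \<Omega> 1 (\<lambda>x. f x t) x = D x"
    and v: "admissible \<Omega> v"
    and PV: "AE x in dom_measure \<Omega>. has_PV (\<lambda>\<alpha>. c * muskat_integrand \<Omega> f x t \<alpha>) (v x)"
  shows "AE x in lborel. has_PV (\<lambda>\<alpha>. c * muskat_kernel F D x \<alpha>) (v x)"
proof -
  let ?w = "wderiv \<Omega> 1 (\<lambda>x. f x t)"
  have w: "is_wderiv \<Omega> 1 (\<lambda>x. f x t) ?w" using in_Hk_wderiv[OF f] k by simp
  have ker: "muskat_integrand \<Omega> f x t = muskat_kernel (\<lambda>x. f x t) ?w x" for x
    by (simp add: fun_eq_iff muskat_integrand_def muskat_kernel_def Let_def)
  have m: "(\<lambda>x. f x t) \<in> borel_measurable borel" "?w \<in> borel_measurable borel"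
    using f w by (auto simp: in_Hk_def is_wderiv_def)
  have "continuous_on UNIV F"
    by (rule continuous_at_imp_continuous_on) (use F DERIV_isCont in blast)
  then have mF: "F \<in> borel_measurable borel" by (rule borel_measurable_continuous_onI)
  have mD: "D \<in> borel_measurable borel"
    using lip lipschitz_imp_continuous_on[of D _ UNIV] by (auto intro: borel_measurable_continuous_onI)
  have "AE x in lborel. has_PV (\<lambda>\<alpha>. c * muskat_integrand \<Omega> f x t \<alpha>) (v x)"
  proof (rule AE_lborel_if_AE_dom[OF PV], intro allI)
    fix x assume T: "\<Omega> = Torus"
    have "f (y + 2 * pi) t = f y t" "?w (y + 2 * pi) = ?w y" "v (y + 2 * pi) = v y" for y
      using f w v T by (auto simp: in_Hk_def is_wderiv_def admissible_def)
    moreover have "x + 2 * pi - \<alpha> = (x - \<alpha>) + 2 * pi" for \<alpha> by simp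
    ultimately have "muskat_integrand \<Omega> f (x + 2 * pi) t \<alpha> = muskat_integrand \<Omega> f x t \<alpha>" "v (x + 2 * pi) = v x" for \<alpha>
      unfolding ker muskat_kernel_def by (simp_all only:)
    then show "has_PV (\<lambda>\<alpha>. c * muskat_integrand \<Omega> f (x + 2 * pi) t \<alpha>) (v (x + 2 * pi)) =
        has_PV (\<lambda>\<alpha>. c * muskat_integrand \<Omega> f x t \<alpha>) (v x)" by simp
  qed
  then show ?thesis using aeF aeD
  proof eventually_elim
    case (elim x)
    show ?case
    proof (rule has_PV_cong_AE[OF elim(1)])
      have "AE \<alpha> in lborel. f (x + (- 1) * \<alpha>) t = F (x + (- 1) * \<alpha>)"
        "AE \<alpha> in lborel. ?w (x + (- 1) * \<alpha>) = D (x + (- 1) * \<alpha>)"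
        by (rule AE_lborel_affine[OF _ aeF], simp) (rule AE_lborel_affine[OF _ aeD], simp)
      then show "AE \<alpha> in lborel. c * muskat_integrand \<Omega> f x t \<alpha> = c * muskat_kernel F D x \<alpha>"
        by eventually_elim (use elim(2,3) in \<open>simp add: ker muskat_kernel_def\<close>)
      show "(\<lambda>\<alpha>. c * muskat_integrand \<Omega> f x t \<alpha>) \<in> borel_measurable borel"
        unfolding ker by (intro borel_measurable_times borel_measurable_const muskat_kernel_measurable m)
      show "(\<lambda>\<alpha>. c * muskat_kernel F D x \<alpha>) \<in> borel_measurable borel"
        by (intro borel_measurable_times borel_measurable_const muskat_kernel_measurable mF mD)
    qed
  qed
qed

text \<open>The Sobolev bound turns convergence in H^k into convergence uniform in x off a null set.
  Its factor 2 is the reason for the threshold e / 2.\<close>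

lemma C1_Hk_AE_difference_quotient:
  assumes C1: "C1_Hk_with_deriv \<Omega> k T f ft" and k: "k \<ge> 1" and t: "t \<in> {0..T}" and e: "e > 0"
  shows "\<forall>\<^sub>F s in at t within {0..T}. AE x in lborel. \<bar>(f x s - f x t) / (s - t) - ft x t\<bar> \<le> e"
proof -
  have H: "in_Hk \<Omega> k (\<lambda>x. f x s)" "in_Hk \<Omega> k (\<lambda>x. ft x s)" if "s \<in> {0..T}" for s
    using C1 that unfolding C1_Hk_with_deriv_def by auto
  have "((\<lambda>s. Hk_norm \<Omega> k (\<lambda>x. (f x s - f x t) / (s - t) - ft x t)) \<longlongrightarrow> 0) (at t within {0..T})"
    using C1 t unfolding C1_Hk_with_deriv_def by blast
  then have "\<forall>\<^sub>F s in at t within {0..T}. Hk_norm \<Omega> k (\<lambda>x. (f x s - f x t) / (s - t) - ft x t) < e / 2"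
    by (rule order_tendstoD(2)) (use e in simp)
  moreover have "\<forall>\<^sub>F s in at t within {0..T}. s \<in> {0..T}" by (simp add: eventually_at_filter)
  ultimately show ?thesis
  proof eventually_elim
    case (elim s)
    have "in_Hk \<Omega> k (\<lambda>x. (1 / (s - t)) * (1 * f x s + (- 1) * f x t) + (- 1) * ft x t)"
      by (intro in_Hk_lincomb H elim(2) t)
    then have "in_Hk \<Omega> k (\<lambda>x. (f x s - f x t) / (s - t) - ft x t)" by simp
    from Sobolev_bound[OF this k] show ?case by eventually_elim (use elim(1) in simp)
  qed
qed

theorem theorem3p1:
  fixes \<Omega> :: domain and k :: nat and \<rho>1 \<rho>2 T :: real
    and f0 :: "real \<Rightarrow> real" and f ft :: "real \<Rightarrow> real \<Rightarrow> real"
  assumes "k \<ge> 3"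
    and "\<rho>2 > \<rho>1" and "\<rho>1 \<ge> 0"
    and "in_Hk \<Omega> k f0"
    and "T > 0"
    and "C1_Hk_with_deriv \<Omega> k T f ft"
    and "\<forall>t\<in>{0..T}. AE x in dom_measure \<Omega>.
           has_PV (\<lambda>\<alpha>. (\<rho>2 - \<rho>1) / (2*pi) * muskat_integrand \<Omega> f x t \<alpha>) (ft x t)"
    and "AE x in dom_measure \<Omega>. f x 0 = f0 x"
  shows "\<forall>t\<in>{0..T}. Linf_norm \<Omega> (\<lambda>x. f x t) \<le> Linf_norm \<Omega> f0"
proof
  fix t assume t: "t \<in> {0..T}"
  define c where "c = (\<rho>2 - \<rho>1) / (2 * pi)"
  have c: "c > 0" using assms(2) by (simp add: c_def)
  have H: "in_Hk \<Omega> k (\<lambda>x. f x t)" "in_Hk \<Omega> k (\<lambda>x. ft x t)" if "t \<in> {0..T}" for t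
    using assms(6) that unfolding C1_Hk_with_deriv_def by auto
  \<comment> \<open>All properties of a representative are bundled so that F and D can be chosen
    simultaneously as functions of time.\<close>
  define R where "R t F D \<longleftrightarrow> (\<forall>x. (F has_real_derivative D x) (at x)) \<and> (\<exists>M. \<forall>x. \<bar>F x\<bar> \<le> M) \<and>
      (\<exists>K. \<forall>x y. \<bar>D x - D y\<bar> \<le> K * \<bar>x - y\<bar>) \<and>
      (AE x in lborel. f x t = F x) \<and> (AE x in lborel. wderiv \<Omega> 1 (\<lambda>x. f x t) x = D x)"
    for t and F D :: "real \<Rightarrow> real"
  have "\<exists>F D. R t F D" if t: "t \<in> {0..T}" for t
  proof (rule in_Hk_regular_representative[OF H(1)[OF t] assms(1)])
    fix F D :: "real \<Rightarrow> real"
    assume "\<And>x. (F has_real_derivative D x) (at x)" "\<exists>M. \<forall>x. \<bar>F x\<bar> \<le> M"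
      "\<exists>K. \<forall>x y. \<bar>D x - D y\<bar> \<le> K * \<bar>x - y\<bar>" "AE x in lborel. f x t = F x"
      "AE x in lborel. wderiv \<Omega> 1 (\<lambda>x. f x t) x = D x"
    then have "R t F D" unfolding R_def by (intro conjI allI)
    then show ?thesis by blast
  qed
  then obtain F D where R: "\<And>t. t \<in> {0..T} \<Longrightarrow> R t (F t) (D t)" by metis
  have F: "\<And>t x. t \<in> {0..T} \<Longrightarrow> (F t has_real_derivative D t x) (at x)"
    and bdd: "\<And>t. t \<in> {0..T} \<Longrightarrow> \<exists>M. \<forall>x. \<bar>F t x\<bar> \<le> M"
    and lip: "\<And>t. t \<in> {0..T} \<Longrightarrow> \<exists>K. \<forall>x y. \<bar>D t x - D t y\<bar> \<le> K * \<bar>x - y\<bar>"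
    and aeF: "\<And>t. t \<in> {0..T} \<Longrightarrow> AE x in lborel. f x t = F t x"
    and aeD: "\<And>t. t \<in> {0..T} \<Longrightarrow> AE x in lborel. wderiv \<Omega> 1 (\<lambda>x. f x t) x = D t x"
    using R unfolding R_def by simp_all
  have PV: "AE x in lborel. has_PV (\<lambda>\<alpha>. c * muskat_kernel (F t) (D t) x \<alpha>) (ft x t)" if t: "t \<in> {0..T}" for t
    by (rule muskat_integrand_AE_kernel[where f = f and t = t, OF H(1)[OF t] assms(1) F[OF t] lip[OF t] aeF[OF t] aeD[OF t]])
      (use H(2)[OF t] assms(7) t in \<open>auto simp: in_Hk_def c_def\<close>)
  have G: "\<exists>B. AE x in lborel. \<bar>ft x t\<bar> \<le> B" if t: "t \<in> {0..T}" for t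
    using Sobolev_bound[OF H(2)[OF t]] assms(1) by auto
  have diff: "\<forall>\<^sub>F s in at t within {0..T}. AE x in lborel. \<bar>(F s x - F t x) / (s - t) - ft x t\<bar> \<le> e"
    if t: "t \<in> {0..T}" and e: "e > 0" for t e
  proof -
    have "\<forall>\<^sub>F s in at t within {0..T}. s \<in> {0..T}" by (simp add: eventually_at_filter)
    moreover have "\<forall>\<^sub>F s in at t within {0..T}. AE x in lborel. \<bar>(f x s - f x t) / (s - t) - ft x t\<bar> \<le> e"
      by (rule C1_Hk_AE_difference_quotient[OF assms(6) _ t e]) (use assms(1) in simp)
    ultimately show ?thesis
    proof eventually_elim
      case (elim s)
      show ?case using elim(2) aeF[OF elim(1)] aeF[OF t] by eventually_elim simp
    qed
  qed
  have Fm: "continuous_on UNIV (F t)" if "t \<in> {0..T}" for t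
    by (rule continuous_at_imp_continuous_on) (use F[OF that] DERIV_isCont in blast)
  show "Linf_norm \<Omega> (\<lambda>x. f x t) \<le> Linf_norm \<Omega> f0"
  \<comment> \<open>It suffices to compare real upper bounds; an infinite initial norm has
    none.\<close>
  proof (rule ereal_le_real)
    fix N :: real assume N: "Linf_norm \<Omega> f0 \<le> ereal N"
    have z: "0 \<in> {0..T}" using assms(5) by simp
    have "AE x in dom_measure \<Omega>. ereal \<bar>f0 x\<bar> \<le> Linf_norm \<Omega> f0" unfolding Linf_norm_def by (rule esssup_AE)
    then have "AE x in dom_measure \<Omega>. \<bar>f x 0\<bar> \<le> N" using assms(8)
    proof eventually_elim
      case (elim x)
      then have "ereal \<bar>f x 0\<bar> \<le> ereal N" using N by (metis order_trans)
      then show ?case by simp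
    qed
    then have "AE x in lborel. \<bar>f x 0\<bar> \<le> N"
      by (rule AE_lborel_if_AE_dom) (use H(1)[OF z] in \<open>simp add: in_Hk_def admissible_def\<close>)
    then have "AE x in lborel. \<bar>F 0 x\<bar> \<le> N" using aeF[OF z] by eventually_elim simp
    then have F0: "\<bar>F 0 x\<bar> \<le> N" for x
      by (rule continuous_le_if_AE_le[rotated 2]) (intro continuous_intros Fm z)+
    have up: "F t x \<le> N" for x
      by (rule muskat_supremum_nonincreasing[where F = F and D = D and G = "\<lambda>t x. ft x t" and T = T, OF c F bdd lip PV G diff _ t])
        (use F0 in \<open>auto simp: abs_le_iff\<close>)
    \<comment> \<open>The kernel changes sign with F and D, so the negative of the solution
      satisfies the same equation with velocity -ft; its supremum bound is the lower bound for
      F.\<close>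
    have "- F t x \<le> N" for x
    proof (rule muskat_supremum_nonincreasing[where F = "\<lambda>t x. - F t x" and D = "\<lambda>t x. - D t x" and G = "\<lambda>t x. - ft x t" and T = T, OF c])
      fix t assume t: "t \<in> {0..T}"
      show "((\<lambda>x. - F t x) has_real_derivative - D t x) (at x)" for x by (intro DERIV_minus F t)
      show "\<exists>M. \<forall>x. \<bar>- F t x\<bar> \<le> M" using bdd[OF t] by simp
      show "\<exists>K. \<forall>x y. \<bar>- D t x - - D t y\<bar> \<le> K * \<bar>x - y\<bar>" using lip[OF t] by (simp add: abs_minus_commute)
      show "AE x in lborel. has_PV (\<lambda>\<alpha>. c * muskat_kernel (\<lambda>x. - F t x) (\<lambda>x. - D t x) x \<alpha>) (- ft x t)"
        using PV[OF t] by eventually_elim (use has_PV_uminus in \<open>fastforce simp: muskat_kernel_uminus\<close>)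
      show "\<exists>B. AE x in lborel. \<bar>- ft x t\<bar> \<le> B" using G[OF t] by simp
      fix e :: real assume "e > 0"
      show "\<forall>\<^sub>F s in at t within {0..T}. AE x in lborel. \<bar>(- F s x - - F t x) / (s - t) - - ft x t\<bar> \<le> e"
        using diff[OF t \<open>e > 0\<close>]
      proof eventually_elim
        case (elim s)
        then show ?case
        proof eventually_elim
          case (elim x)
          have "(- F s x - - F t x) / (s - t) - - ft x t = - ((F s x - F t x) / (s - t) - ft x t)"
            by (simp add: diff_divide_distrib)
          then show ?case using elim by (simp only: abs_minus_cancel)
        qed
      qed
    qed (use F0 t in \<open>auto simp: abs_le_iff\<close>)
    then have "\<bar>F t x\<bar> \<le> N" for x using up[of x] by (auto simp: abs_le_iff)
    then have "AE x in lborel. \<bar>f x t\<bar> \<le> N" using aeF[OF t] by (auto elim: eventually_mono)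
    then have "AE x in dom_measure \<Omega>. ereal \<bar>f x t\<bar> \<le> ereal N" unfolding AE_dom by eventually_elim simp
    moreover have "(\<lambda>x. ereal \<bar>f x t\<bar>) \<in> borel_measurable (dom_measure \<Omega>)"
    proof -
      have [measurable]: "(\<lambda>x. f x t) \<in> borel_measurable borel" using H(1)[OF t] by (simp add: in_Hk_def)
      show ?thesis unfolding dom_measure_eq by (rule measurable_restrict_space1) simp
    qed
    ultimately show "Linf_norm \<Omega> (\<lambda>x. f x t) \<le> ereal N" unfolding Linf_norm_def by blast
  qed
qed

end
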